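(* For $b\in F(s)$, let $\bar b$ be the unique Yamanouchi tableau such that $b=\dot f_{j_t}^{\,*}\cdots\dot f_{j_1}^{\,*}f_{i_r}\cdots f_{i_1}\bar b$ for some sequences $i_1,\dots,i_r\in\{1,\dots,n-1\}$ and $j_1,\dots,j_t\in\{1,\dots,\ell-1\}$, and set $P(b)=f_{i_r}\cdots f_{i_1}\bar b$ and $Q(b)=\dot f_{j_t}\cdots\dot f_{j_1}\bar b^*$. Then $P(b)$ is a tableau and $Q(b)$ is an antitableau whose shape is the transpose of the shape of $P(b)$. Moreover the map $\Phi:b\mapsto(P(b),Q(b))$ is a bijection from $F(s)$ onto its image, and one has the decomposition of $(A_{n-1}\times A_{\ell-1})$-crystals $$F(s)\simeq\bigoplus_{\lambda\in\mathcal S(s)}B(\lambda)\otimes\dot B(\lambda^{\mathrm{tr}}).$$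
   Context: Fix integers $n,\ell\ge2$, $s\ge0$. $F(s)$: set of $b=c_\ell\otimes\cdots\otimes c_1$, $c_j\subseteq\{1,\dots,n\}$, $\sum|c_j|=s$; $\dot F(s)$: set of $d_1\otimes\cdots\otimes d_n$, $d_i\subseteq\{1,\dots,\ell\}$, $\sum|d_i|=s$. Duality $b^*=d(1)\otimes\cdots\otimes d(n)$, $d(i)=\{j:i\in c_j\}$; for $\varphi$ on $\dot F(s)$, $\varphi^*(b)=(\varphi(b^* ))^*$ (or $0$ if $\varphi(b^* )=0$). Crystal operators: the word of $c_\ell\otimes\cdots\otimes c_1$ concatenates entries of $c_\ell$ (increasing), ..., $c_1$; the word of $d_1\otimes\cdots\otimes d_n$ concatenates $d_1,\dots,d_n$. For letters $k,k+1$: encode $k$ as $+$, $k+1$ as $-$, delete adjacent $+-$ recursively; lowering changes the $k$ of the leftmost remaining $+$ into $k+1$ (or $0$), raising changes the $k+1$ of the rightmost remaining $-$ into $k$ (or $0$); this gives $f_i,e_i$ ($1\le i\le n-1$, type $A_{n-1}$) on $F(s)$ and $\dot f_j,\dot e_j$ ($1\le j\le\ell-1$, type $A_{\ell-1}$) on $\dot F(s)$; $F(s)$ is an $(A_{n-1}\times A_{\ell-1})$-crystal via $f_i$ and $\dot f_j^{\,*}$. Yamanouchi: every prefix of the word has at least as many letters $k$ as $k+1$. $c_\ell\otimes\cdots\otimes c_1$ is a tableau (resp. antitableau) if $c_1,\dots,c_\ell$ placed left to right top-aligned (resp. bottom-aligned) form a semistandard Young tableau (resp. semistandard skew Young tableau);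 for $d_1\otimes\cdots\otimes d_n$ the same with columns placed in order $d_n,\dots,d_1$. Shape of a tableau $c_\ell\otimes\cdots\otimes c_1$: the partition conjugate to $(|c_1|,\dots,|c_\ell|)$; shape of an antitableau $d_1\otimes\cdots\otimes d_n$: the partition conjugate to $(|d_1|,\dots,|d_n|)$. $\mathcal S(s)$: partitions of $s$ with at most $n$ parts and first part $\le\ell$. $B(\lambda)$: the set of tableaux of shape $\lambda$ in $F(s)$ (a connected $A_{n-1}$-crystal, the crystal of highest weight $\lambda$); $\dot B(\mu)$: the set of antitableaux of shape $\mu$ in $\dot F(s)$ (a connected $A_{\ell-1}$-crystal). (That $\bar b$ exists and is unique is the fact that each connected component of the $(A_{n-1}\times A_{\ell-1})$-crystal $F(s)$ has a unique source, a Yamanouchi tableau.) *)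

theory Defs
  imports Main
begin

section \<open>Configurations of columns and duality\<close>

text \<open>
  A configuration is a map from column positions to finite sets of letters.
  \<open>Fset n l s\<close> is the set of \<open>c\<^sub>l \<otimes> \<dots> \<otimes> c\<^sub>1\<close> with letters in \<open>{1..n}\<close>, the column
  \<open>c\<^sub>j\<close> being \<open>c j\<close>; \<open>Fdot n l s\<close> is the set of \<open>d\<^sub>1 \<otimes> \<dots> \<otimes> d\<^sub>n\<close> with letters in
  \<open>{1..l}\<close>, the column \<open>d\<^sub>i\<close> being \<open>d i\<close>. Positions that are not used hold the empty set,
  so that equality of configurations is equality of functions. The order in which the
  columns are written matters only for reading words and is passed as a list of positions.
\<close>

type_synonym config = "nat \<Rightarrow> nat set"

definition configs :: "nat \<Rightarrow> nat \<Rightarrow> nat \<Rightarrow> config set" where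
  "configs m q s = {c. (\<forall>p. c p \<subseteq> {1..m}) \<and> (\<forall>p. p \<notin> {1..q} \<longrightarrow> c p = {})
                     \<and> (\<Sum>p = 1..q. card (c p)) = s}"

definition Fset :: "nat \<Rightarrow> nat \<Rightarrow> nat \<Rightarrow> config set" where
  "Fset n l s = configs n l s"

definition Fdot :: "nat \<Rightarrow> nat \<Rightarrow> nat \<Rightarrow> config set" where
  "Fdot n l s = configs l n s"

text \<open>The same formula gives the duality in both directions.\<close>

definition dual :: "config \<Rightarrow> config" where
  "dual c = (\<lambda>i. {j. i \<in> c j})"

definition dual_op :: "(config \<Rightarrow> config option) \<Rightarrow> config \<Rightarrow> config option" where
  "dual_op \<phi> b = map_option dual (\<phi> (dual b))"


section \<open>Reading words and crystal operators\<close>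

text \<open>
  \<open>reading ps c\<close> lists the pairs (position of the column, letter) in reading order;
  keeping the position lets an operator change one occurrence of a letter in place.
\<close>

definition reading :: "nat list \<Rightarrow> config \<Rightarrow> (nat \<times> nat) list" where
  "reading ps c = concat (map (\<lambda>p. map (Pair p) (sorted_list_of_set (c p))) ps)"

definition reading_word :: "nat list \<Rightarrow> config \<Rightarrow> nat list" where
  "reading_word ps c = map snd (reading ps c)"

definition orderF :: "nat \<Rightarrow> nat list" where
  "orderF l = rev [1..<Suc l]"

definition orderFdot :: "nat \<Rightarrow> nat list" where
  "orderFdot n = [1..<Suc n]"

text \<open>
  The letter \<open>k\<close> plays the role of \<open>+\<close> and \<open>k + 1\<close> that of \<open>-\<close>. The relation \<open>cancel\<close> deletes
  one adjacent pair \<open>+-\<close>; the function \<open>unmatched\<close> computes its normal form, as shown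
  by \<open>unmatched_cancel\<close> and \<open>unmatched_irreducible\<close>.
\<close>

inductive cancel :: "nat \<Rightarrow> (nat \<times> nat) list \<Rightarrow> (nat \<times> nat) list \<Rightarrow> bool" for k where
  "cancel k (u @ (p, k) # (q, Suc k) # v) (u @ v)"

fun push :: "nat \<Rightarrow> nat \<times> nat \<Rightarrow> (nat \<times> nat) list \<Rightarrow> (nat \<times> nat) list" where
  "push k a [] = [a]"
| "push k a (b # w) = (if snd a = k \<and> snd b = Suc k then w else a # b # w)"

definition unmatched :: "nat \<Rightarrow> (nat \<times> nat) list \<Rightarrow> (nat \<times> nat) list" where
  "unmatched k w = foldr (push k) (filter (\<lambda>(p, x). x = k \<or> x = Suc k) w) []"

lemma cancel_Cons: "cancel k v w \<Longrightarrow> cancel k (a # v) (a # w)"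
  by (metis append_Cons cancel.cases cancel.intros)

lemma cancel_rtranclp_Cons: "(cancel k)\<^sup>*\<^sup>* v w \<Longrightarrow> (cancel k)\<^sup>*\<^sup>* (a # v) (a # w)"
  by (induction rule: rtranclp_induct) (auto intro: cancel_Cons rtranclp.rtrancl_into_rtrancl)

lemma push_cancel: "(cancel k)\<^sup>*\<^sup>* (a # w) (push k a w)"
proof (cases w)
  case (Cons b v)
  obtain p x q y where "a = (p, x)" "b = (q, y)" by (cases a, cases b)
  with Cons show ?thesis using cancel.intros[of k "[]" p q v] by auto
qed auto

lemma unmatched_cancel:
  "(cancel k)\<^sup>*\<^sup>* (filter (\<lambda>(p, x). x = k \<or> x = Suc k) w) (unmatched k w)"
proof -
  have "(cancel k)\<^sup>*\<^sup>* v (foldr (push k) v [])" for v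
  proof (induction v)
    case (Cons a v)
    then show ?case
      using cancel_rtranclp_Cons[OF Cons.IH, of a] push_cancel[of k a] by (simp add: rtranclp_trans)
  qed simp
  then show ?thesis unfolding unmatched_def .
qed

lemma cancel_ConsE:
  assumes "cancel k (a # w) v"
  shows "(\<exists>v'. cancel k w v') \<or> (\<exists>q w'. snd a = k \<and> w = (q, Suc k) # w')"
  using assms
proof cases
  case (1 u p q v)
  then show ?thesis by (cases u) (auto intro: cancel.intros)
qed

lemma unmatched_irreducible: "\<not> cancel k (unmatched k w) v"
proof -
  have nil: "\<not> cancel k [] v" for v by (auto elim: cancel.cases)
  have "\<not> cancel k (foldr (push k) u []) v" for u v
  proof (induction u arbitrary: v)
    case (Cons a u)
    show ?case
    proof (cases "foldr (push k) u []")
      case Nil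
      then show ?thesis using nil cancel_ConsE[of k a "[]" v] by auto
    next
      case (Cons b w)
      then show ?thesis using Cons.IH cancel_ConsE[of k a "b # w" v] cancel_Cons[of k w v b] by auto
    qed
  qed (use nil in simp)
  then show ?thesis unfolding unmatched_def .
qed

text \<open>\<open>None\<close> stands for the value \<open>0\<close> of an operator.\<close>

definition lower_op :: "nat list \<Rightarrow> nat \<Rightarrow> config \<Rightarrow> config option" where
  "lower_op ps k c =
     (case filter (\<lambda>(p, x). x = k) (unmatched k (reading ps c)) of
        [] \<Rightarrow> None
      | (p, x) # _ \<Rightarrow> Some (c(p := insert (Suc k) (c p - {k}))))"

definition raise_op :: "nat list \<Rightarrow> nat \<Rightarrow> config \<Rightarrow> config option" where
  "raise_op ps k c =
     (case rev (filter (\<lambda>(p, x). x = Suc k) (unmatched k (reading ps c))) of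
        [] \<Rightarrow> None
      | (p, x) # _ \<Rightarrow> Some (c(p := insert k (c p - {Suc k}))))"

definition f_op :: "nat \<Rightarrow> nat \<Rightarrow> config \<Rightarrow> config option" where
  "f_op l i = lower_op (orderF l) i"

definition e_op :: "nat \<Rightarrow> nat \<Rightarrow> config \<Rightarrow> config option" where
  "e_op l i = raise_op (orderF l) i"

definition fdot_op :: "nat \<Rightarrow> nat \<Rightarrow> config \<Rightarrow> config option" where
  "fdot_op n j = lower_op (orderFdot n) j"

definition edot_op :: "nat \<Rightarrow> nat \<Rightarrow> config \<Rightarrow> config option" where
  "edot_op n j = raise_op (orderFdot n) j"

text \<open>\<open>apply_seq f [i\<^sub>1, \<dots>, i\<^sub>r] b\<close> is \<open>f i\<^sub>r (\<dots> (f i\<^sub>1 b))\<close>: the head acts first.\<close>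

fun apply_seq :: "('i \<Rightarrow> 'a \<Rightarrow> 'a option) \<Rightarrow> 'i list \<Rightarrow> 'a \<Rightarrow> 'a option" where
  "apply_seq f [] b = Some b"
| "apply_seq f (i # ii) b = Option.bind (f i b) (apply_seq f ii)"

definition yamanouchi :: "nat list \<Rightarrow> bool" where
  "yamanouchi w \<longleftrightarrow>
     (\<forall>m. \<forall>k \<ge> 1. count_list (take m w) (Suc k) \<le> count_list (take m w) k)"


section \<open>Tableaux, antitableaux and shapes\<close>

text \<open>
  Columns are given from left to right. A column is filled by its elements, increasing
  from top to bottom, so only the shape and the weak increase along rows are conditions.
  Top-aligned columns form a Young diagram when their heights weakly decrease;
  bottom-aligned ones form the skew diagram of a rectangle minus a partition in its upper left
  corner when their heights weakly increase. Rows are counted from the aligned side.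
\<close>

definition top_ssyt :: "nat set list \<Rightarrow> bool" where
  "top_ssyt cs \<longleftrightarrow> sorted_wrt (\<lambda>A B. card B \<le> card A \<and>
     (\<forall>r < card B. sorted_list_of_set A ! r \<le> sorted_list_of_set B ! r)) cs"

definition bottom_ssyt :: "nat set list \<Rightarrow> bool" where
  "bottom_ssyt cs \<longleftrightarrow> sorted_wrt (\<lambda>A B. card A \<le> card B \<and>
     (\<forall>r < card A. rev (sorted_list_of_set A) ! r \<le> rev (sorted_list_of_set B) ! r)) cs"

definition tableau :: "nat \<Rightarrow> config \<Rightarrow> bool" where
  "tableau l c \<longleftrightarrow> top_ssyt (map c [1..<Suc l])"

definition antitableau_dot :: "nat \<Rightarrow> config \<Rightarrow> bool" where
  "antitableau_dot n d \<longleftrightarrow> bottom_ssyt (map d (rev [1..<Suc n]))"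

text \<open>Partitions are weakly decreasing lists of positive integers.\<close>

definition conj_part :: "nat list \<Rightarrow> nat list" where
  "conj_part xs = map (\<lambda>r. length (filter (\<lambda>x. r \<le> x) xs)) [1..<Suc (Max (insert 0 (set xs)))]"

definition shape :: "nat \<Rightarrow> config \<Rightarrow> nat list" where
  "shape l c = conj_part (map (\<lambda>j. card (c j)) [1..<Suc l])"

definition shape_dot :: "nat \<Rightarrow> config \<Rightarrow> nat list" where
  "shape_dot n d = conj_part (map (\<lambda>i. card (d i)) [1..<Suc n])"

definition partitions_in_box :: "nat \<Rightarrow> nat \<Rightarrow> nat \<Rightarrow> nat list set" where
  "partitions_in_box n l s =
     {la. sorted_wrt (\<ge>) la \<and> 0 \<notin> set la \<and> sum_list la = s \<and> length la \<le> n \<and> (\<forall>x \<in> set la. x \<le> l)}"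


section \<open>Crystals\<close>

text \<open>
  \<open>wt C b i\<close> is the pairing of the weight of \<open>b\<close> with the \<open>i\<close>-th simple coroot. The string
  lengths \<open>\<epsilon>\<^sub>i\<close> and \<open>\<phi>\<^sub>i\<close> are the numbers of times \<open>e\<^sub>i\<close> and \<open>f\<^sub>i\<close> can be applied; they are determined
  by the operators and hence not recorded.
\<close>

record ('a, 'i) crystal =
  elts :: "'a set"
  eop :: "'i \<Rightarrow> 'a \<Rightarrow> 'a option"
  fop :: "'i \<Rightarrow> 'a \<Rightarrow> 'a option"
  wt :: "'a \<Rightarrow> 'i \<Rightarrow> int"

definition crystal_iso ::
  "'i set \<Rightarrow> ('a, 'i) crystal \<Rightarrow> ('b, 'i) crystal \<Rightarrow> ('a \<Rightarrow> 'b) \<Rightarrow> bool" where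
  "crystal_iso I C D \<psi> \<longleftrightarrow> bij_betw \<psi> (elts C) (elts D) \<and>
     (\<forall>i \<in> I. \<forall>b \<in> elts C.
        eop D i (\<psi> b) = map_option \<psi> (eop C i b) \<and>
        fop D i (\<psi> b) = map_option \<psi> (fop C i b) \<and>
        wt D (\<psi> b) i = wt C b i)"

definition crystals_isomorphic ::
  "'i set \<Rightarrow> ('a, 'i) crystal \<Rightarrow> ('b, 'i) crystal \<Rightarrow> bool" where
  "crystals_isomorphic I C D \<longleftrightarrow> (\<exists>\<psi>. crystal_iso I C D \<psi>)"

text \<open>
  For an \<open>I\<close>-crystal \<open>A\<close> and a \<open>J\<close>-crystal \<open>B\<close> the tensor product is the crystal over the disjoint
  union of \<open>I\<close> and \<open>J\<close> in which \<open>I\<close> acts on the first factor only and \<open>J\<close> on the second only.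
\<close>

definition tensor_crystal ::
  "('a, 'i) crystal \<Rightarrow> ('b, 'j) crystal \<Rightarrow> ('a \<times> 'b, 'i + 'j) crystal" where
  "tensor_crystal A B =
     \<lparr> elts = elts A \<times> elts B,
       eop = case_sum (\<lambda>i (a, b). map_option (\<lambda>a'. (a', b)) (eop A i a))
                      (\<lambda>j (a, b). map_option (\<lambda>b'. (a, b')) (eop B j b)),
       fop = case_sum (\<lambda>i (a, b). map_option (\<lambda>a'. (a', b)) (fop A i a))
                      (\<lambda>j (a, b). map_option (\<lambda>b'. (a, b')) (fop B j b)),
       wt = (\<lambda>(a, b). case_sum (wt A a) (wt B b)) \<rparr>"

definition direct_sum_crystal ::
  "'k set \<Rightarrow> ('k \<Rightarrow> ('a, 'i) crystal) \<Rightarrow> ('k \<times> 'a, 'i) crystal" where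
  "direct_sum_crystal K C =
     \<lparr> elts = Sigma K (\<lambda>k. elts (C k)),
       eop = (\<lambda>i (k, a). map_option (Pair k) (eop (C k) i a)),
       fop = (\<lambda>i (k, a). map_option (Pair k) (fop (C k) i a)),
       wt = (\<lambda>(k, a). wt (C k) a) \<rparr>"

definition word_wt :: "nat list \<Rightarrow> nat \<Rightarrow> int" where
  "word_wt w k = int (count_list w k) - int (count_list w (Suc k))"

text \<open>Index set of type \<open>A\<^sub>n\<^sub>-\<^sub>1 \<times> A\<^sub>l\<^sub>-\<^sub>1\<close>.\<close>

definition indices :: "nat \<Rightarrow> nat \<Rightarrow> (nat + nat) set" where
  "indices n l = {1..<n} <+> {1..<l}"

definition F_crystal :: "nat \<Rightarrow> nat \<Rightarrow> nat \<Rightarrow> (config, nat + nat) crystal" where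
  "F_crystal n l s =
     \<lparr> elts = Fset n l s,
       eop = case_sum (e_op l) (\<lambda>j. dual_op (edot_op n j)),
       fop = case_sum (f_op l) (\<lambda>j. dual_op (fdot_op n j)),
       wt = (\<lambda>b. case_sum (word_wt (reading_word (orderF l) b))
                          (word_wt (reading_word (orderFdot n) (dual b)))) \<rparr>"

definition B_crystal :: "nat \<Rightarrow> nat \<Rightarrow> nat \<Rightarrow> nat list \<Rightarrow> (config, nat) crystal" where
  "B_crystal n l s la =
     \<lparr> elts = {c \<in> Fset n l s. tableau l c \<and> shape l c = la},
       eop = e_op l,
       fop = f_op l,
       wt = (\<lambda>c. word_wt (reading_word (orderF l) c)) \<rparr>"

definition Bdot_crystal :: "nat \<Rightarrow> nat \<Rightarrow> nat \<Rightarrow> nat list \<Rightarrow> (config, nat) crystal" where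
  "Bdot_crystal n l s \<mu> =
     \<lparr> elts = {d \<in> Fdot n l s. antitableau_dot n d \<and> shape_dot n d = \<mu>},
       eop = edot_op n,
       fop = fdot_op n,
       wt = (\<lambda>d. word_wt (reading_word (orderFdot n) d)) \<rparr>"


section \<open>The correspondence\<close>

text \<open>
  \<open>factorization n l s b u ii jj\<close>: \<open>u\<close> is a Yamanouchi tableau and \<open>b\<close> is obtained from it by
  first applying the operators \<open>f\<close> along \<open>ii\<close> and then the dual operators along \<open>jj\<close>.
\<close>

definition factorization ::
  "nat \<Rightarrow> nat \<Rightarrow> nat \<Rightarrow> config \<Rightarrow> config \<Rightarrow> nat list \<Rightarrow> nat list \<Rightarrow> bool" where
  "factorization n l s b u ii jj \<longleftrightarrow>
     u \<in> Fset n l s \<and> tableau l u \<and> yamanouchi (reading_word (orderF l) u) \<and>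
     set ii \<subseteq> {1..n - 1} \<and> set jj \<subseteq> {1..l - 1} \<and>
     Option.bind (apply_seq (f_op l) ii u) (apply_seq (\<lambda>j. dual_op (fdot_op n j)) jj) = Some b"

definition source :: "nat \<Rightarrow> nat \<Rightarrow> nat \<Rightarrow> config \<Rightarrow> config" where
  "source n l s b = (THE u. \<exists>ii jj. factorization n l s b u ii jj)"

definition P_symbol :: "nat \<Rightarrow> nat \<Rightarrow> nat \<Rightarrow> config \<Rightarrow> config" where
  "P_symbol n l s b =
     (THE p. \<exists>ii jj. factorization n l s b (source n l s b) ii jj \<and>
                     apply_seq (f_op l) ii (source n l s b) = Some p)"

definition Q_symbol :: "nat \<Rightarrow> nat \<Rightarrow> nat \<Rightarrow> config \<Rightarrow> config" where
  "Q_symbol n l s b =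
     (THE q. \<exists>ii jj. factorization n l s b (source n l s b) ii jj \<and>
                     apply_seq (fdot_op n) jj (dual (source n l s b)) = Some q)"

definition Phi :: "nat \<Rightarrow> nat \<Rightarrow> nat \<Rightarrow> config \<Rightarrow> config \<times> config" where
  "Phi n l s b = (P_symbol n l s b, Q_symbol n l s b)"

end

(* Encode a configuration as a 0-1 matrix with rows 1..n and columns 1..l. The operators f_i move an
   entry from row i to row i+1 inside a column, the operators fdot_j^* from column j to column j+1
   inside a row. A 2 x 2 analysis shows that the two families commute and do not affect whether an
   operator of the other family is defined.

   An element killed by all raising operators of both families is the filling of a partition: the
   conditions are the Yamanouchi property (equivalently, the dual is an antitableau) and the tableau
   property, and together they force column j to be {1..m_j}. Such a source is therefore determined
   by its column sizes, which the f_i preserve, and also by its row sizes, which the fdot_j^*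
   preserve. Commutation turns these two invariants into uniqueness of the source below b, of P and
   of Q, and into equivariance of b |-> (P, Q), so neither insertion nor local confluence is needed. *)
theory Submission
  imports Defs "HOL-Combinatorics.Transposition"
begin

section \<open>The bracket rule\<close>

text \<open>\<open>f_i\<close> reads only rows i and i + 1, and a dual operator with index j changes
  only columns j and j + 1, so the two moves can interfere in four cells only. There the choice of
  the leftmost unmatched sign matters: it forbids exactly the fillings in which the moved entry
  would have been cancelled or overtaken by its neighbour. In the fillings that remain, a sign
  trades places with a 0, or an adjacent pair +- appears or disappears, and none of this is noticed
  by the bracket rule. The obstacle to uniqueness is that neither invariant of the source can be
  read off b: its column sizes are altered by the dual operators, its row sizes by the
  \<open>f_i\<close>. Two factorizations of b are therefore compared by mixing them, climbing from b
  with the raising operators of both families. Hence commutation is proved for raising as well as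
  lowering operators, four pairs in all, and in a form that also transports undefinedness: this is
  what moves the property of being killed by all raising operators of one family along the operators
  of the other.\<close>

text \<open>The state of the bracket rule, read from the right for signs \<open>1\<close>, \<open>-1\<close>, \<open>0\<close>: the number of unmatched
  \<open>-\<close>, the leftmost unmatched \<open>+\<close> and the rightmost unmatched \<open>-\<close>.\<close>

primrec minus_count :: "('a \<Rightarrow> int) \<Rightarrow> 'a list \<Rightarrow> nat" where
  "minus_count \<sigma> [] = 0"
| "minus_count \<sigma> (p # ps) =
    (if \<sigma> p = 1 then minus_count \<sigma> ps - 1
     else if \<sigma> p = -1 then Suc (minus_count \<sigma> ps) else minus_count \<sigma> ps)"

primrec first_plus :: "('a \<Rightarrow> int) \<Rightarrow> 'a list \<Rightarrow> 'a option" where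
  "first_plus \<sigma> [] = None"
| "first_plus \<sigma> (p # ps) = (if \<sigma> p = 1 \<and> minus_count \<sigma> ps = 0 then Some p else first_plus \<sigma> ps)"

primrec last_minus :: "('a \<Rightarrow> int) \<Rightarrow> 'a list \<Rightarrow> 'a option" where
  "last_minus \<sigma> [] = None"
| "last_minus \<sigma> (p # ps) =
    (if \<sigma> p = 1 then (if minus_count \<sigma> ps \<le> 1 then None else last_minus \<sigma> ps)
     else if \<sigma> p = -1 \<and> minus_count \<sigma> ps = 0 then Some p else last_minus \<sigma> ps)"

lemma last_minus_None_iff: "last_minus \<sigma> ps = None \<longleftrightarrow> minus_count \<sigma> ps = 0"
  by (induction ps) auto

lemma first_plus_SomeD: "first_plus \<sigma> ps = Some p \<Longrightarrow> p \<in> set ps \<and> \<sigma> p = 1"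
  by (induction ps) (auto split: if_splits)

lemma last_minus_SomeD: "last_minus \<sigma> ps = Some p \<Longrightarrow> p \<in> set ps \<and> \<sigma> p = -1"
  by (induction ps) (auto split: if_splits)

lemma bracket_cong:
  assumes "\<And>p. p \<in> set ps \<Longrightarrow> \<sigma> p = \<tau> p"
  shows "minus_count \<sigma> ps = minus_count \<tau> ps" "first_plus \<sigma> ps = first_plus \<tau> ps"
proof -
  have "minus_count \<sigma> ps = minus_count \<tau> ps \<and> first_plus \<sigma> ps = first_plus \<tau> ps"
    using assms by (induction ps) auto
  then show "minus_count \<sigma> ps = minus_count \<tau> ps" "first_plus \<sigma> ps = first_plus \<tau> ps" by auto
qed

text \<open>The unmatched signs form a word -...-+...+. Flipping its leftmost + shifts the boundary
  by one place and matches nothing new, so the flipped sign becomes the rightmost unmatched -. This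
  is why raising undoes lowering.\<close>

lemma last_minus_after_first_plus:
  assumes "distinct ps" "first_plus \<sigma> ps = Some p"
  shows "minus_count (\<sigma>(p := -1)) ps = Suc (minus_count \<sigma> ps) \<and> last_minus (\<sigma>(p := -1)) ps = Some p"
  using assms
proof (induction ps)
  case (Cons q ps)
  show ?case
  proof (cases "p = q")
    case True
    have "minus_count (\<sigma>(p := -1)) ps = minus_count \<sigma> ps"
      using Cons.prems True by (intro bracket_cong) auto
    moreover have "\<sigma> q = 1" "minus_count \<sigma> ps = 0"
      using Cons.prems True by (auto split: if_splits dest!: first_plus_SomeD)
    ultimately show ?thesis using True by (simp add: fun_upd_def)
  next
    case False
    then show ?thesis using Cons by (auto split: if_splits)
  qed
qed simp

lemma first_plus_after_last_minus:
  assumes "distinct ps" "last_minus \<sigma> ps = Some p"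
  shows "Suc (minus_count (\<sigma>(p := 1)) ps) = minus_count \<sigma> ps \<and> first_plus (\<sigma>(p := 1)) ps = Some p"
  using assms
proof (induction ps)
  case (Cons q ps)
  show ?case
  proof (cases "p = q")
    case True
    have "minus_count (\<sigma>(p := 1)) ps = minus_count \<sigma> ps"
      using Cons.prems True by (intro bracket_cong) auto
    moreover have "\<sigma> q = -1" "minus_count \<sigma> ps = 0"
      using Cons.prems True by (auto split: if_splits dest!: last_minus_SomeD)
    ultimately show ?thesis using True by (simp add: fun_upd_def)
  next
    case False
    then show ?thesis using Cons by (auto split: if_splits)
  qed
qed simp

lemma minus_count_eq_0_iff:
  assumes "\<And>p. p \<in> set ps \<Longrightarrow> \<sigma> p \<in> {-1, 0, 1}"
  shows "minus_count \<sigma> ps = 0 \<longleftrightarrow> (\<forall>t. 0 \<le> sum_list (map \<sigma> (take t ps)))"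
proof -
  \<comment> \<open>A prepended sign shifts all later prefix sums, so the induction has to run over
    every bound m: the number of unmatched - is the largest value of minus a prefix sum.\<close>
  have "minus_count \<sigma> ps \<le> m \<longleftrightarrow> (\<forall>t. - int m \<le> sum_list (map \<sigma> (take t ps)))" for m
    using assms
  proof (induction ps arbitrary: m)
    case (Cons q ps)
    have IH: "minus_count \<sigma> ps \<le> m \<longleftrightarrow> (\<forall>t. - int m \<le> sum_list (map \<sigma> (take t ps)))" for m
      using Cons by simp
    have split: "(\<forall>t. - int m \<le> sum_list (map \<sigma> (take t (q # ps)))) \<longleftrightarrow>
        (\<forall>t. - int m \<le> \<sigma> q + sum_list (map \<sigma> (take t ps)))" for m
    proof -
      have "(\<forall>t. Q t) \<longleftrightarrow> Q 0 \<and> (\<forall>t. Q (Suc t))" for Q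
        by (metis not0_implies_Suc)
      from this[of "\<lambda>t. - int m \<le> sum_list (map \<sigma> (take t (q # ps)))"] show ?thesis by simp
    qed
    have "\<sigma> q = -1 \<or> \<sigma> q = 0 \<or> \<sigma> q = 1" using Cons.prems by auto
    then show ?case
    proof (elim disjE)
      assume s: "\<sigma> q = 1"
      have "minus_count \<sigma> (q # ps) \<le> m \<longleftrightarrow> minus_count \<sigma> ps \<le> Suc m" using s by auto
      moreover have "- int m \<le> 1 + y \<longleftrightarrow> - int (Suc m) \<le> y" for y by auto
      ultimately show ?thesis unfolding split s IH[of "Suc m"] by simp
    next
      assume s: "\<sigma> q = -1"
      show ?thesis
      proof (cases m)
        case 0
        have "\<exists>t. \<not> - int m \<le> \<sigma> q + sum_list (map \<sigma> (take t ps))"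
          using s 0 by (intro exI[of _ 0]) simp
        then show ?thesis unfolding split using s 0 by auto
      next
        case (Suc m')
        then have "minus_count \<sigma> (q # ps) \<le> m \<longleftrightarrow> minus_count \<sigma> ps \<le> m'" using s by auto
        moreover have "- int m \<le> -1 + y \<longleftrightarrow> - int m' \<le> y" for y using Suc by auto
        ultimately show ?thesis unfolding split s IH[of m'] by simp
      qed
    next
      assume s: "\<sigma> q = 0"
      then show ?thesis unfolding split using IH by simp
    qed
  qed simp
  from this[of 0] show ?thesis by simp
qed

text \<open>What happens to two adjacent positions of a row signature when a column operator moves an entry
  between them, and conversely.\<close>

definition block_move :: "('a \<Rightarrow> int) \<Rightarrow> ('a \<Rightarrow> int) \<Rightarrow> 'a \<Rightarrow> 'a \<Rightarrow> bool" where
  "block_move \<sigma> \<tau> p q \<longleftrightarrow>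
     (\<tau> p = \<sigma> q \<and> \<tau> q = \<sigma> p \<and> (\<sigma> p = 0 \<or> \<sigma> q = 0)) \<or>
     (\<sigma> p = 0 \<and> \<sigma> q = 0 \<and> \<tau> p = 1 \<and> \<tau> q = -1) \<or>
     (\<sigma> p = 1 \<and> \<sigma> q = -1 \<and> \<tau> p = 0 \<and> \<tau> q = 0)"

text \<open>In each case of \<open>block_move\<close> the signs at p and q reduce to the same word
  once zeros and adjacent +- are deleted; only the position carrying the surviving sign may change,
  hence the transposition. In the two cases with a pair +- neither p nor q carries the first
  unmatched +, so the transposition has no effect.\<close>

lemma bracket_block:
  assumes out: "\<And>x. x \<noteq> p \<Longrightarrow> x \<noteq> q \<Longrightarrow> \<tau> x = \<sigma> x"
    and "distinct (u @ p # q # v)"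
    and "block_move \<sigma> \<tau> p q"
  shows "minus_count \<tau> (u @ p # q # v) = minus_count \<sigma> (u @ p # q # v) \<and>
    first_plus \<tau> (u @ p # q # v) = map_option (transpose p q) (first_plus \<sigma> (u @ p # q # v))"
  using assms(2)
proof (induction u)
  case Nil
  have eq: "\<tau> x = \<sigma> x" if "x \<in> set v" for x
    using Nil out[of x] that by auto
  have v: "minus_count \<tau> v = minus_count \<sigma> v" "first_plus \<tau> v = first_plus \<sigma> v"
    by (rule bracket_cong[OF eq], assumption)+
  have "map_option (transpose p q) (first_plus \<sigma> v) = first_plus \<sigma> v"
    using Nil by (cases "first_plus \<sigma> v") (auto simp: transpose_def dest: first_plus_SomeD)
  moreover have "transpose p q p = q" "transpose p q q = p" by (simp_all add: transpose_def)
  ultimately show ?case using assms(3) unfolding block_move_def by (elim disjE conjE) (simp_all add: v)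
next
  case (Cons x u)
  then have "\<tau> x = \<sigma> x" "transpose p q x = x" using out[of x] by (auto simp: transpose_def)
  moreover have "minus_count \<tau> (u @ p # q # v) = minus_count \<sigma> (u @ p # q # v)"
    "first_plus \<tau> (u @ p # q # v) = map_option (transpose p q) (first_plus \<sigma> (u @ p # q # v))"
    using Cons by simp_all
  ultimately show ?case by simp
qed

text \<open>A - directly after the + would have cancelled it.\<close>

lemma first_plus_block_first:
  assumes "distinct (u @ p # q # v)" "first_plus \<sigma> (u @ p # q # v) = Some p"
  shows "\<sigma> p = 1 \<and> \<sigma> q \<noteq> -1"
  using assms by (induction u) (auto split: if_splits dest: first_plus_SomeD)

text \<open>Since q is unmatched, no unmatched - lies to its right; a + at p would then be unmatched
  too, and further left.\<close>

lemma first_plus_block_second: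
  assumes "distinct (u @ p # q # v)" "first_plus \<sigma> (u @ p # q # v) = Some q"
  shows "\<sigma> q = 1 \<and> \<sigma> p \<noteq> 1"
  using assms by (induction u) (auto split: if_splits dest: first_plus_SomeD)

section \<open>From letters in reading words to one sign per column\<close>

definition col_sign :: "nat \<Rightarrow> config \<Rightarrow> nat \<Rightarrow> int" where
  "col_sign k c p = of_bool (k \<in> c p) - of_bool (Suc k \<in> c p)"

definition letter_sign :: "nat \<Rightarrow> nat \<Rightarrow> int" where
  "letter_sign k x = of_bool (x = k) - of_bool (x = Suc k)"

definition psign :: "nat \<Rightarrow> nat \<times> nat \<Rightarrow> int" where
  "psign k a = letter_sign k (snd a)"

text \<open>The normal form is kept as \<open>A @ B\<close>, the - before the +. A new + on the left
  cancels the first entry of \<open>A\<close>, so the rightmost unmatched - survives unless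
  \<open>A\<close> had length one; this is the test against 1 in \<open>last_minus\<close>.\<close>

lemma foldr_push_bracket:
  assumes "\<forall>a \<in> set w. snd a = k \<or> snd a = Suc k"
  shows "\<exists>A B. foldr (push k) w [] = A @ B \<and> (\<forall>a \<in> set A. snd a = Suc k) \<and> (\<forall>b \<in> set B. snd b = k) \<and>
    minus_count (psign k) w = length A \<and>
    first_plus (psign k) w = (if B = [] then None else Some (hd B)) \<and>
    last_minus (psign k) w = (if A = [] then None else Some (last A))"
  using assms
proof (induction w)
  case (Cons a w)
  then obtain A B where AB: "foldr (push k) w [] = A @ B"
    "\<forall>a \<in> set A. snd a = Suc k" "\<forall>b \<in> set B. snd b = k"
    "minus_count (psign k) w = length A"
    "first_plus (psign k) w = (if B = [] then None else Some (hd B))"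
    "last_minus (psign k) w = (if A = [] then None else Some (last A))" by auto
  consider "snd a = Suc k" | "snd a = k" "A = []" | a' A' where "snd a = k" "A = a' # A'"
    using Cons.prems by (cases A) auto
  then show ?case
  proof cases
    case 1
    then have "foldr (push k) (a # w) [] = (a # A) @ B"
      using AB(1) by (cases "A @ B") auto
    moreover have "psign k a = -1" using 1 by (simp add: psign_def letter_sign_def)
    ultimately show ?thesis using 1 AB
      by (intro exI[of _ "a # A"] exI[of _ B]) simp
  next
    case 2
    then have "foldr (push k) (a # w) [] = [] @ (a # B)"
      using AB(1,3) by (cases B) auto
    moreover have "psign k a = 1" using 2 by (simp add: psign_def letter_sign_def)
    ultimately show ?thesis using 2 AB
      by (intro exI[of _ "[]"] exI[of _ "a # B"]) simp
  next
    case 3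
    then have "foldr (push k) (a # w) [] = A' @ B" using AB(1,2) by simp
    moreover have "psign k a = 1" using 3 by (simp add: psign_def letter_sign_def)
    ultimately show ?thesis using 3 AB
      by (intro exI[of _ A'] exI[of _ B]) simp
  qed
qed (auto intro: exI[of _ "[]"])

lemma filter_sorted_list_of_set:
  fixes A :: "'a::linorder set"
  assumes "finite A"
  shows "filter P (sorted_list_of_set A) = sorted_list_of_set {x \<in> A. P x}"
proof (rule sorted_distinct_set_unique)
  show "sorted (filter P (sorted_list_of_set A))"
    using sorted_filter[of id "sorted_list_of_set A" P] by simp
qed (use assms in auto)

lemma filter_column:
  fixes A :: "nat set"
  assumes "finite A"
  shows "filter (\<lambda>x. x = k \<or> x = Suc k) (sorted_list_of_set A) =
    (if k \<in> A then [k] else []) @ (if Suc k \<in> A then [Suc k] else [])"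
proof -
  have "{x \<in> A. x = k \<or> x = Suc k} = set ((if k \<in> A then [k] else []) @ (if Suc k \<in> A then [Suc k] else []))"
    by auto
  then show ?thesis
    unfolding filter_sorted_list_of_set[OF assms]
    by (auto intro!: sorted_distinct_set_unique simp del: sorted_list_of_set_insert_remove)
qed

lemma reading_Cons: "reading (p # ps) c = map (Pair p) (sorted_list_of_set (c p)) @ reading ps c"
  by (simp add: reading_def)

text \<open>Among the letters k and k + 1 of one column, k is read immediately before k + 1, so a
  column containing both cancels by itself and counts as 0. From here on the bracket rule runs over
  column positions instead of letters.\<close>

lemma bracket_reading:
  fixes c :: config and k :: nat and ps :: "nat list"
  assumes "\<forall>p. finite (c p)"
  defines "w \<equiv> filter (\<lambda>(p, x). x = k \<or> x = Suc k) (reading ps c)"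
  shows "minus_count (psign k) w = minus_count (col_sign k c) ps \<and>
    first_plus (psign k) w = map_option (\<lambda>p. (p, k)) (first_plus (col_sign k c) ps) \<and>
    last_minus (psign k) w = map_option (\<lambda>p. (p, Suc k)) (last_minus (col_sign k c) ps)"
  unfolding w_def
proof (induction ps)
  case Nil
  then show ?case by (simp add: reading_def)
next
  case (Cons p ps)
  define v where "v = filter (\<lambda>(p, x). x = k \<or> x = Suc k) (reading ps c)"
  have r: "filter (\<lambda>(p, x). x = k \<or> x = Suc k) (reading (p # ps) c) =
    (if k \<in> c p then [(p, k)] else []) @ (if Suc k \<in> c p then [(p, Suc k)] else []) @ v"
    using filter_column[of "c p" k] assms(1)
    by (simp add: reading_Cons filter_map o_def v_def)
  have IH: "minus_count (psign k) v = minus_count (col_sign k c) ps"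
    "first_plus (psign k) v = map_option (\<lambda>p. (p, k)) (first_plus (col_sign k c) ps)"
    "last_minus (psign k) v = map_option (\<lambda>p. (p, Suc k)) (last_minus (col_sign k c) ps)"
    using Cons by (simp_all add: v_def)
  have sign: "psign k (p, k) = 1" "psign k (p, Suc k) = -1"
    by (simp_all add: psign_def letter_sign_def)
  have "col_sign k c p = of_bool (k \<in> c p) - of_bool (Suc k \<in> c p)" by (simp add: col_sign_def)
  then show ?case unfolding r using last_minus_None_iff[of "col_sign k c" ps]
    by (cases "k \<in> c p"; cases "Suc k \<in> c p") (auto simp: sign IH)
qed

section \<open>The crystal operators as moves of a single entry\<close>

definition move_up :: "nat \<Rightarrow> config \<Rightarrow> nat \<Rightarrow> config" where
  "move_up k c p = c(p := insert (Suc k) (c p - {k}))"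

definition move_down :: "nat \<Rightarrow> config \<Rightarrow> nat \<Rightarrow> config" where
  "move_down k c p = c(p := insert k (c p - {Suc k}))"

lemma unmatched_eq:
  assumes "\<forall>p. finite (c p)"
  shows "\<exists>A B. unmatched k (reading ps c) = A @ B \<and> (\<forall>a \<in> set A. snd a = Suc k) \<and> (\<forall>b \<in> set B. snd b = k) \<and>
    map_option (\<lambda>p. (p, k)) (first_plus (col_sign k c) ps) = (if B = [] then None else Some (hd B)) \<and>
    map_option (\<lambda>p. (p, Suc k)) (last_minus (col_sign k c) ps) = (if A = [] then None else Some (last A))"
proof -
  define w where "w = filter (\<lambda>(p, x). x = k \<or> x = Suc k) (reading ps c)"
  have "\<forall>a \<in> set w. snd a = k \<or> snd a = Suc k" by (auto simp: w_def)
  from foldr_push_bracket[OF this] show ?thesis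
    using bracket_reading[OF assms, of k ps]
    unfolding unmatched_def w_def[symmetric] by (elim exE conjE) (intro exI conjI, assumption+, simp_all)
qed

lemma lower_op_eq:
  assumes "\<forall>p. finite (c p)"
  shows "lower_op ps k c = map_option (move_up k c) (first_plus (col_sign k c) ps)"
proof -
  obtain A B where AB: "unmatched k (reading ps c) = A @ B"
    "\<forall>a \<in> set A. snd a = Suc k" "\<forall>b \<in> set B. snd b = k"
    "map_option (\<lambda>p. (p, k)) (first_plus (col_sign k c) ps) = (if B = [] then None else Some (hd B))"
    using unmatched_eq[OF assms] by metis
  have "filter (\<lambda>(p, x). x = k) A = []" "filter (\<lambda>(p, x). x = k) B = B"
    using AB(2,3) by (auto simp: filter_empty_conv filter_id_conv)
  then show ?thesis
    using AB by (cases B) (auto simp: lower_op_def move_up_def)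
qed

lemma raise_op_eq:
  assumes "\<forall>p. finite (c p)"
  shows "raise_op ps k c = map_option (move_down k c) (last_minus (col_sign k c) ps)"
proof -
  obtain A B where AB: "unmatched k (reading ps c) = A @ B"
    "\<forall>a \<in> set A. snd a = Suc k" "\<forall>b \<in> set B. snd b = k"
    "map_option (\<lambda>p. (p, Suc k)) (last_minus (col_sign k c) ps) = (if A = [] then None else Some (last A))"
    using unmatched_eq[OF assms] by metis
  have "filter (\<lambda>(p, x). x = Suc k) A = A" "filter (\<lambda>(p, x). x = Suc k) B = []"
    using AB(2,3) by (auto simp: filter_empty_conv filter_id_conv)
  then show ?thesis
    using AB by (cases A rule: rev_cases) (auto simp: raise_op_def move_down_def)
qed

lemma col_sign_move_up: "col_sign k c p = 1 \<Longrightarrow> col_sign k (move_up k c p) = (col_sign k c)(p := -1)"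
  by (cases "k \<in> c p"; cases "Suc k \<in> c p") (auto simp: col_sign_def move_up_def fun_eq_iff)

lemma col_sign_move_down: "col_sign k c p = -1 \<Longrightarrow> col_sign k (move_down k c p) = (col_sign k c)(p := 1)"
  by (cases "k \<in> c p"; cases "Suc k \<in> c p") (auto simp: col_sign_def move_down_def fun_eq_iff)

lemma move_down_up: "col_sign k c p = 1 \<Longrightarrow> move_down k (move_up k c p) p = c"
  by (cases "k \<in> c p"; cases "Suc k \<in> c p") (auto simp: col_sign_def move_up_def move_down_def fun_eq_iff)

lemma move_up_down: "col_sign k c p = -1 \<Longrightarrow> move_up k (move_down k c p) p = c"
  by (cases "k \<in> c p"; cases "Suc k \<in> c p") (auto simp: col_sign_def move_up_def move_down_def fun_eq_iff)

lemma lower_raise_iff: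
  assumes "distinct ps" "\<forall>p. finite (b p)" "\<forall>p. finite (c p)"
  shows "lower_op ps k b = Some c \<longleftrightarrow> raise_op ps k c = Some b"
proof
  assume "lower_op ps k b = Some c"
  then obtain p where p: "first_plus (col_sign k b) ps = Some p" "c = move_up k b p"
    unfolding lower_op_eq[OF assms(2)] by auto
  then have s: "col_sign k b p = 1" using first_plus_SomeD by metis
  then have "last_minus (col_sign k c) ps = Some p"
    using last_minus_after_first_plus[OF assms(1) p(1)] p col_sign_move_up by simp
  then show "raise_op ps k c = Some b"
    unfolding raise_op_eq[OF assms(3)] using s p move_down_up by simp
next
  assume "raise_op ps k c = Some b"
  then obtain p where p: "last_minus (col_sign k c) ps = Some p" "b = move_down k c p"
    unfolding raise_op_eq[OF assms(3)] by auto
  then have s: "col_sign k c p = -1" using last_minus_SomeD by metis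
  then have "first_plus (col_sign k b) ps = Some p"
    using first_plus_after_last_minus[OF assms(1) p(1)] p col_sign_move_down by simp
  then show "lower_op ps k b = Some c"
    unfolding lower_op_eq[OF assms(2)] using s p move_up_down by simp
qed

lemma raise_op_None_iff:
  assumes "\<forall>p. finite (c p)"
  shows "raise_op ps k c = None \<longleftrightarrow> minus_count (col_sign k c) ps = 0"
  by (simp add: raise_op_eq[OF assms] last_minus_None_iff)

lemma lower_op_None_iff:
  assumes "\<forall>p. finite (c p)"
  shows "lower_op ps k c = None \<longleftrightarrow> first_plus (col_sign k c) ps = None"
  by (simp add: lower_op_eq[OF assms])


section \<open>Commutation of row and column operators\<close>

lemma dual_dual [simp]: "dual (dual c) = c"
  by (simp add: dual_def)

lemma mem_dual [simp]: "j \<in> dual c i \<longleftrightarrow> i \<in> c j"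
  by (simp add: dual_def)

lemma mem_move_up:
  "x \<in> move_up k c p y \<longleftrightarrow> (if y = p then x = Suc k \<or> (x \<in> c p \<and> x \<noteq> k) else x \<in> c y)"
  by (auto simp: move_up_def)

lemma adjacent_split:
  assumes "1 \<le> k" "k < m"
  shows "\<exists>u v. [1..<Suc m] = u @ k # Suc k # v"
proof -
  have "[1..<Suc m] = [1..<k] @ [k..<Suc m]"
    using assms upt_add_eq_append[of 1 k "Suc m - k"] by simp
  moreover have "[k..<Suc m] = k # Suc k # [Suc (Suc k)..<Suc m]"
    using assms by (simp add: upt_conv_Cons)
  ultimately show ?thesis by metis
qed

lemma adjacent_split_rev:
  assumes "1 \<le> k" "k < m"
  shows "\<exists>u v. rev [1..<Suc m] = u @ Suc k # k # v"
proof -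
  obtain u v where "[1..<Suc m] = u @ k # Suc k # v"
    using adjacent_split[OF assms] by blast
  then have "rev [1..<Suc m] = rev v @ Suc k # k # rev u" by simp
  then show ?thesis by blast
qed

lemma distinct_orders [simp]: "distinct (orderF l)" "distinct (orderFdot n)"
  by (simp_all add: orderF_def orderFdot_def)

lemma set_orders [simp]: "set (orderF l) = {1..l}" "set (orderFdot n) = {1..n}"
  by (auto simp: orderF_def orderFdot_def)

lemma col_sign_values: "col_sign k c p \<in> {-1, 0, 1}"
  by (simp add: col_sign_def)

lemma col_sign_eq_1: "col_sign k c p = 1 \<longleftrightarrow> k \<in> c p \<and> Suc k \<notin> c p"
  by (simp add: col_sign_def)

lemma col_sign_eq_m1: "col_sign k c p = -1 \<longleftrightarrow> k \<notin> c p \<and> Suc k \<in> c p"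
  by (simp add: col_sign_def)

text \<open>The move takes place in row r, so it is seen by the signature of rows i and i + 1 only
  if r is one of them, and then only at the positions j + 1 and j, which are neighbours in
  \<open>orderF\<close>. The count decides whether \<open>e_op\<close> is defined, the first +
  decides where \<open>f_op\<close> acts.\<close>

lemma row_signs_after_column_move:
  assumes i: "1 \<le> i" "i < n" and j: "1 \<le> j" "j < l"
    and r: "first_plus (col_sign j (dual b)) (orderFdot n) = Some r"
  defines "c \<equiv> dual (move_up j (dual b) r)"
  shows "minus_count (col_sign i c) (orderF l) = minus_count (col_sign i b) (orderF l) \<and>
    first_plus (col_sign i c) (orderF l) =
      map_option (if r = i \<or> r = Suc i then transpose (Suc j) j else id) (first_plus (col_sign i b) (orderF l))"
proof -
  obtain u v where uv: "orderF l = u @ Suc j # j # v"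
    using adjacent_split_rev[OF j] unfolding orderF_def by blast
  obtain u' v' where uv': "orderFdot n = u' @ i # Suc i # v'"
    using adjacent_split[OF i] unfolding orderFdot_def by blast
  have d: "distinct (u @ Suc j # j # v)" "distinct (u' @ i # Suc i # v')"
    using distinct_orders uv uv' by metis+
  have c: "x \<in> c y \<longleftrightarrow> (if x = r then y = Suc j \<or> (x \<in> b y \<and> y \<noteq> j) else x \<in> b y)" for x y
    by (auto simp: c_def mem_move_up)
  have out: "col_sign i c p = col_sign i b p" if "p \<noteq> Suc j" "p \<noteq> j" for p
    using that by (simp add: col_sign_def c)
  consider "r \<noteq> i" "r \<noteq> Suc i" | "r = i" | "r = Suc i" by blast
  then show ?thesis
  proof cases
    case 1
    then have "col_sign i c p = col_sign i b p" for p by (simp add: col_sign_def c)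
    then have "col_sign i c = col_sign i b" by blast
    then show ?thesis using 1 by (simp add: option.map_id)
  next
    case 2
    have "col_sign j (dual b) i = 1" "col_sign j (dual b) (Suc i) \<noteq> -1"
      using first_plus_block_first[OF d(2)] r 2 unfolding uv' by auto
    \<comment> \<open>The implication excludes that row i + 1 has its only entry of the block in
      column j + 1. If row i + 1 is empty or full on the two columns, a sign trades places with 0;
      if it meets column j only, 00 becomes +-.\<close>
    then have "i \<in> b j" "i \<notin> b (Suc j)" "Suc i \<in> b (Suc j) \<longrightarrow> Suc i \<in> b j"
      by (auto simp: col_sign_eq_1 col_sign_eq_m1)
    then have "block_move (col_sign i b) (col_sign i c) (Suc j) j"
      using 2 by (cases "Suc i \<in> b j"; cases "Suc i \<in> b (Suc j)") (auto simp: block_move_def col_sign_def c)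
    from bracket_block[OF out d(1) this] show ?thesis using 2 unfolding uv by auto
  next
    case 3
    have "col_sign j (dual b) (Suc i) = 1" "col_sign j (dual b) i \<noteq> 1"
      using first_plus_block_second[OF d(2)] r 3 unfolding uv' by auto
    \<comment> \<open>Now row i must not have its only entry in column j. If row i is empty or full
      on the two columns, a sign trades places with 0; if it meets column j + 1 only, +- becomes
      00.\<close>
    then have "Suc i \<in> b j" "Suc i \<notin> b (Suc j)" "i \<in> b j \<longrightarrow> i \<in> b (Suc j)"
      by (auto simp: col_sign_eq_1)
    then have "block_move (col_sign i b) (col_sign i c) (Suc j) j"
      using 3 by (cases "i \<in> b j"; cases "i \<in> b (Suc j)") (auto simp: block_move_def col_sign_def c)
    from bracket_block[OF out d(1) this] show ?thesis using 3 unfolding uv by auto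
  qed
qed

text \<open>The mirror image for the other family, except that rows are read upwards and columns
  downwards: here \<open>Suc j\<close> is the first position of the adjacent pair, where
  \<open>i\<close> was before.\<close>

lemma column_signs_after_row_move:
  assumes i: "1 \<le> i" "i < n" and j: "1 \<le> j" "j < l"
    and q: "first_plus (col_sign i b) (orderF l) = Some q"
  defines "c \<equiv> dual (move_up i b q)"
  shows "minus_count (col_sign j c) (orderFdot n) = minus_count (col_sign j (dual b)) (orderFdot n) \<and>
    first_plus (col_sign j c) (orderFdot n) =
      map_option (if q = j \<or> q = Suc j then transpose i (Suc i) else id) (first_plus (col_sign j (dual b)) (orderFdot n))"
proof -
  obtain u v where uv: "orderF l = u @ Suc j # j # v"
    using adjacent_split_rev[OF j] unfolding orderF_def by blast
  obtain u' v' where uv': "orderFdot n = u' @ i # Suc i # v'"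
    using adjacent_split[OF i] unfolding orderFdot_def by blast
  have d: "distinct (u @ Suc j # j # v)" "distinct (u' @ i # Suc i # v')"
    using distinct_orders uv uv' by metis+
  have c: "y \<in> c x \<longleftrightarrow> (if y = q then x = Suc i \<or> (x \<in> b y \<and> x \<noteq> i) else x \<in> b y)" for x y
    by (auto simp: c_def mem_move_up)
  have out: "col_sign j c p = col_sign j (dual b) p" if "p \<noteq> i" "p \<noteq> Suc i" for p
    using that by (simp add: col_sign_def c)
  consider "q \<noteq> j" "q \<noteq> Suc j" | "q = Suc j" | "q = j" by blast
  then show ?thesis
  proof cases
    case 1
    then have "col_sign j c p = col_sign j (dual b) p" for p by (simp add: col_sign_def c)
    then have "col_sign j c = col_sign j (dual b)" by blast
    then show ?thesis using 1 by (simp add: option.map_id)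
  next
    case 2
    have "col_sign i b (Suc j) = 1" "col_sign i b j \<noteq> -1"
      using first_plus_block_first[OF d(1)] q 2 unfolding uv by auto
    then have "i \<in> b (Suc j)" "Suc i \<notin> b (Suc j)" "Suc i \<in> b j \<longrightarrow> i \<in> b j"
      by (auto simp: col_sign_eq_1 col_sign_eq_m1)
    then have "block_move (col_sign j (dual b)) (col_sign j c) i (Suc i)"
      using 2 by (cases "i \<in> b j"; cases "Suc i \<in> b j") (auto simp: block_move_def col_sign_def c)
    from bracket_block[OF out d(2) this] show ?thesis using 2 unfolding uv' by auto
  next
    case 3
    have "col_sign i b j = 1" "col_sign i b (Suc j) \<noteq> 1"
      using first_plus_block_second[OF d(1)] q 3 unfolding uv by auto
    then have "i \<in> b j" "Suc i \<notin> b j" "i \<in> b (Suc j) \<longrightarrow> Suc i \<in> b (Suc j)"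
      by (auto simp: col_sign_eq_1)
    then have "block_move (col_sign j (dual b)) (col_sign j c) i (Suc i)"
      using 3 by (cases "i \<in> b (Suc j)"; cases "Suc i \<in> b (Suc j)") (auto simp: block_move_def col_sign_def c)
    from bracket_block[OF out d(2) this] show ?thesis using 3 unfolding uv' by auto
  qed
qed

text \<open>When the two moves meet in the common block, each displaces the site of the other by a
  transposition. With the displaced sites known, the two composites are compared cell by
  cell.\<close>

lemma moves_commute:
  assumes i: "1 \<le> i" "i < n" and j: "1 \<le> j" "j < l"
    and q: "first_plus (col_sign i b) (orderF l) = Some q"
    and r: "first_plus (col_sign j (dual b)) (orderFdot n) = Some r"
  defines "c \<equiv> move_up i b q" and "d \<equiv> dual (move_up j (dual b) r)"
  shows "\<exists>q' r'. first_plus (col_sign i d) (orderF l) = Some q' \<and> first_plus (col_sign j (dual c)) (orderFdot n) = Some r' \<and>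
    move_up i d q' = dual (move_up j (dual c) r')"
proof -
  have 1: "first_plus (col_sign i d) (orderF l) = Some (if r = i \<or> r = Suc i then transpose (Suc j) j q else q)"
    using row_signs_after_column_move[OF i j r] q by (simp add: d_def)
  have 2: "first_plus (col_sign j (dual c)) (orderFdot n) = Some (if q = j \<or> q = Suc j then transpose i (Suc i) r else r)"
    using column_signs_after_row_move[OF i j q] r by (simp add: c_def)
  have mem: "i \<in> b q" "Suc i \<notin> b q" "r \<in> b j" "r \<notin> b (Suc j)"
    using first_plus_SomeD[OF q] first_plus_SomeD[OF r] by (auto simp: col_sign_eq_1)
  have c: "x \<in> c y \<longleftrightarrow> (if y = q then x = Suc i \<or> (x \<in> b y \<and> x \<noteq> i) else x \<in> b y)" for x y
    by (auto simp: c_def mem_move_up)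
  have d: "x \<in> d y \<longleftrightarrow> (if x = r then y = Suc j \<or> (x \<in> b y \<and> y \<noteq> j) else x \<in> b y)" for x y
    by (auto simp: d_def mem_move_up)
  have "x \<in> move_up i d (if r = i \<or> r = Suc i then transpose (Suc j) j q else q) y \<longleftrightarrow>
    x \<in> dual (move_up j (dual c) (if q = j \<or> q = Suc j then transpose i (Suc i) r else r)) y" for x y
    unfolding mem_dual mem_move_up
    using mem by (auto simp: c d transpose_def split: if_splits)
  then show ?thesis using 1 2 by blast
qed


section \<open>Commuting families of operators\<close>

definition closed_under :: "'a set \<Rightarrow> ('a \<Rightarrow> 'a option) \<Rightarrow> bool" where
  "closed_under X x \<longleftrightarrow> (\<forall>b \<in> X. \<forall>c. x b = Some c \<longrightarrow> c \<in> X)"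

definition inverse_ops :: "'a set \<Rightarrow> ('a \<Rightarrow> 'a option) \<Rightarrow> ('a \<Rightarrow> 'a option) \<Rightarrow> bool" where
  "inverse_ops X x y \<longleftrightarrow> (\<forall>b \<in> X. \<forall>c \<in> X. x b = Some c \<longleftrightarrow> y c = Some b)"

lemma closed_underD: "closed_under X x \<Longrightarrow> b \<in> X \<Longrightarrow> x b = Some c \<Longrightarrow> c \<in> X"
  unfolding closed_under_def by blast

lemma inverse_opsD:
  assumes "inverse_ops X x y" "b \<in> X" "c \<in> X"
  shows "x b = Some c \<longleftrightarrow> y c = Some b"
  using assms unfolding inverse_ops_def by blast

text \<open>Stronger than equality of the two composites: each operator also preserves and
  reflects definedness of the other.\<close>

definition commuting :: "'a set \<Rightarrow> ('a \<Rightarrow> 'a option) \<Rightarrow> ('a \<Rightarrow> 'a option) \<Rightarrow> bool" where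
  "commuting X x y \<longleftrightarrow> (\<forall>b \<in> X.
     (\<forall>c d. x b = Some c \<longrightarrow> y b = Some d \<longrightarrow> (\<exists>z. x d = Some z \<and> y c = Some z)) \<and>
     (\<forall>c. x b = Some c \<longrightarrow> y b = None \<longrightarrow> y c = None) \<and>
     (\<forall>d. y b = Some d \<longrightarrow> x b = None \<longrightarrow> x d = None))"

lemma commuting_both:
  assumes "commuting X x y" "b \<in> X" "x b = Some c" "y b = Some d"
  shows "\<exists>z. x d = Some z \<and> y c = Some z"
  using assms(1)[unfolded commuting_def, THEN bspec, OF assms(2), THEN conjunct1] assms(3,4) by simp

lemma commuting_None_iff:
  assumes "commuting X x y" "b \<in> X" "x b = Some c"
  shows "y c = None \<longleftrightarrow> y b = None"
proof (cases "y b")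
  case None
  then show ?thesis
    using assms(1)[unfolded commuting_def, THEN bspec, OF assms(2), THEN conjunct2, THEN conjunct1]
      assms(3) by simp
next
  case (Some d)
  then show ?thesis using commuting_both[OF assms Some] by auto
qed

lemma commuting_sym:
  assumes "commuting X x y"
  shows "commuting X y x"
  unfolding commuting_def[of X y x]
proof (intro ballI conjI allI impI)
  fix b c d assume "b \<in> X" "y b = Some c" "x b = Some d"
  then show "\<exists>z. y d = Some z \<and> x c = Some z" using commuting_both[OF assms] by blast
next
  fix b c assume "b \<in> X" "y b = Some c" "x b = None"
  then show "x c = None"
    using assms[unfolded commuting_def, THEN bspec, THEN conjunct2, THEN conjunct2] by simp
next
  fix b d assume "b \<in> X" "x b = Some d" "y b = None"
  then show "y d = None" using commuting_None_iff[OF assms] by simp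
qed

text \<open>Completes a square from one of its two paths rather than from a corner with two arrows;
  the second arrow at b exists because definedness is reflected.\<close>

lemma commuting_later:
  assumes "commuting X x y" "b \<in> X" "x b = Some c" "y c = Some z"
  shows "\<exists>d. y b = Some d \<and> x d = Some z"
proof -
  obtain d where "y b = Some d"
    using commuting_None_iff[OF assms(1-3)] assms(4) by (cases "y b") auto
  then show ?thesis using commuting_both[OF assms(1-3)] assms(4) by auto
qed

text \<open>Squares of x are read backwards as squares of x'. Reversal says nothing where x' is
  undefined, which is what the last hypothesis supplies.\<close>

lemma commuting_inverse:
  assumes "commuting X x y" "inverse_ops X x x'" "closed_under X x'" "closed_under X y"
    and "\<And>b c. b \<in> X \<Longrightarrow> y b = Some c \<Longrightarrow> x' c = None \<longleftrightarrow> x' b = None"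
  shows "commuting X x' y"
  unfolding commuting_def
proof (intro ballI conjI allI impI)
  fix b c d assume b: "b \<in> X" and c: "x' b = Some c" and d: "y b = Some d"
  have X: "c \<in> X" "d \<in> X" using closed_underD[OF assms(3) b c] closed_underD[OF assms(4) b d] .
  have "x c = Some b" using inverse_opsD[OF assms(2) X(1) b] c by simp
  from commuting_later[OF assms(1) X(1) this d]
  obtain z where z: "y c = Some z" "x z = Some d" by blast
  have "z \<in> X" using closed_underD[OF assms(4) X(1) z(1)] .
  then show "\<exists>z. x' d = Some z \<and> y c = Some z"
    using inverse_opsD[OF assms(2) _ X(2)] z by simp
next
  fix b c assume b: "b \<in> X" and c: "x' b = Some c" and d: "y b = None"
  have X: "c \<in> X" using closed_underD[OF assms(3) b c] .
  have "x c = Some b" using inverse_opsD[OF assms(2) X b] c by simp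
  then show "y c = None" using commuting_None_iff[OF assms(1) X] d by simp
next
  fix b d assume "b \<in> X" "y b = Some d" "x' b = None"
  then show "x' d = None" using assms(5) by simp
qed

lemma apply_seq_single: "apply_seq x [i] = x i"
proof
  show "apply_seq x [i] b = x i b" for b by (cases "x i b") simp_all
qed

lemma apply_seq_append: "apply_seq f (ii @ kk) b = Option.bind (apply_seq f ii b) (apply_seq f kk)"
  by (induction ii arbitrary: b) (auto simp: bind_eq_Some_conv split: bind_splits)

lemma apply_seq_closed:
  assumes "\<And>i. i \<in> set ii \<Longrightarrow> closed_under X (x i)"
  shows "closed_under X (apply_seq x ii)"
proof -
  have "b \<in> X \<Longrightarrow> apply_seq x ii b = Some c \<Longrightarrow> c \<in> X" for b c
    using assms
  proof (induction ii arbitrary: b)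
    case (Cons i ii)
    then obtain b' where "x i b = Some b'" "apply_seq x ii b' = Some c"
      by (auto simp: bind_eq_Some_conv)
    moreover from this Cons.prems have "b' \<in> X"
      by (intro closed_underD[of X "x i" b b']) simp_all
    ultimately show ?case using Cons.IH Cons.prems by simp
  qed simp
  then show ?thesis unfolding closed_under_def by blast
qed

lemma apply_seq_commuting:
  assumes "\<And>i. i \<in> set ii \<Longrightarrow> closed_under X (x i)"
    and "\<And>i. i \<in> set ii \<Longrightarrow> commuting X (x i) y"
  shows "commuting X (apply_seq x ii) y"
  using assms
proof (induction ii)
  case Nil
  then show ?case by (simp add: commuting_def)
next
  case (Cons i ii)
  have IH: "commuting X (apply_seq x ii) y" using Cons by simp
  have i: "commuting X (x i) y" "closed_under X (x i)" using Cons.prems by simp_all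
  show ?case unfolding commuting_def
  proof (intro ballI conjI allI impI)
    fix b c d assume b: "b \<in> X" and c: "apply_seq x (i # ii) b = Some c" and d: "y b = Some d"
    obtain b' where b': "x i b = Some b'" "apply_seq x ii b' = Some c"
      using c by (auto simp: bind_eq_Some_conv)
    have "b' \<in> X" using closed_underD[OF i(2) b b'(1)] .
    then show "\<exists>z. apply_seq x (i # ii) d = Some z \<and> y c = Some z"
      using commuting_both[OF i(1) b b'(1) d] commuting_both[OF IH _ b'(2)] by auto
  next
    fix b c assume b: "b \<in> X" and c: "apply_seq x (i # ii) b = Some c" and d: "y b = None"
    obtain b' where b': "x i b = Some b'" "apply_seq x ii b' = Some c"
      using c by (auto simp: bind_eq_Some_conv)
    have "b' \<in> X" using closed_underD[OF i(2) b b'(1)] .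
    then show "y c = None"
      using commuting_None_iff[OF i(1) b b'(1)] commuting_None_iff[OF IH _ b'(2)] d by simp
  next
    fix b d assume b: "b \<in> X" and d: "y b = Some d" and c: "apply_seq x (i # ii) b = None"
    show "apply_seq x (i # ii) d = None"
    proof (cases "x i b")
      case None
      then show ?thesis using commuting_None_iff[OF commuting_sym[OF i(1)] b d] by simp
    next
      case (Some b')
      have "b' \<in> X" using closed_underD[OF i(2) b Some] .
      moreover obtain z where "x i d = Some z" "y b' = Some z"
        using commuting_both[OF i(1) b Some d] by blast
      ultimately show ?thesis
        using commuting_None_iff[OF commuting_sym[OF IH], of b' z] c Some by simp
    qed
  qed
qed

lemma apply_seq_commuting2:
  assumes "\<And>i. i \<in> set ii \<Longrightarrow> closed_under X (x i)" "\<And>j. j \<in> set jj \<Longrightarrow> closed_under X (y j)"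
    and "\<And>i j. i \<in> set ii \<Longrightarrow> j \<in> set jj \<Longrightarrow> commuting X (x i) (y j)"
  shows "commuting X (apply_seq x ii) (apply_seq y jj)"
  proof (rule apply_seq_commuting[OF assms(1)])
  fix i assume i: "i \<in> set ii"
  show "commuting X (x i) (apply_seq y jj)"
    using assms(2) commuting_sym[OF assms(3)[OF i]] by (intro commuting_sym[OF apply_seq_commuting])
qed

lemma apply_seq_inverse:
  assumes "\<And>i. i \<in> set ii \<Longrightarrow> closed_under X (x i)" "\<And>i. i \<in> set ii \<Longrightarrow> inverse_ops X (x i) (y i)"
    and "b \<in> X" "apply_seq x ii b = Some c"
  shows "apply_seq y (rev ii) c = Some b"
  using assms
proof (induction ii arbitrary: b)
  case (Cons i ii)
  obtain b' where b': "x i b = Some b'" "apply_seq x ii b' = Some c"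
    using Cons.prems by (auto simp: bind_eq_Some_conv)
  have "closed_under X (x i)" using Cons.prems by simp
  from closed_underD[OF this \<open>b \<in> X\<close> b'(1)] have X: "b' \<in> X" .
  moreover have "inverse_ops X (x i) (y i)" using Cons.prems by simp
  then have "y i b' = Some b" using inverse_opsD[OF _ \<open>b \<in> X\<close> X] b'(1) by simp
  moreover have "apply_seq y (rev ii) c = Some b'"
    using Cons.prems by (intro Cons.IH X b'(2)) simp_all
  ultimately show ?case by (simp add: apply_seq_append)
qed simp

text \<open>The measure grows along x, hence drops along the inverse y, so climbing by y stops; the
  climb read backwards is the word \<open>ii\<close>.\<close>

lemma reach_source:
  fixes m :: "'a \<Rightarrow> nat"
  assumes "\<And>i. i \<in> I \<Longrightarrow> closed_under X (y i)" "\<And>i. i \<in> I \<Longrightarrow> inverse_ops X (x i) (y i)"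
    and "\<And>i b c. i \<in> I \<Longrightarrow> b \<in> X \<Longrightarrow> x i b = Some c \<Longrightarrow> m b < m c"
    and "b \<in> X"
  shows "\<exists>ii u. set ii \<subseteq> I \<and> u \<in> X \<and> (\<forall>i \<in> I. y i u = None) \<and> apply_seq x ii u = Some b"
  using assms(4)
proof (induction "m b" arbitrary: b rule: less_induct)
  case less
  show ?case
  proof (cases "\<forall>i \<in> I. y i b = None")
    case True
    then show ?thesis using less.prems by (intro exI[of _ "[]"] exI[of _ b]) simp
  next
    case False
    then obtain i c where i: "i \<in> I" "y i b = Some c" by auto
    have c: "c \<in> X" using closed_underD[OF assms(1)[OF i(1)] less.prems i(2)] .
    have x: "x i c = Some b" using inverse_opsD[OF assms(2)[OF i(1)] c less.prems] i(2) by simp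
    have "m c < m b" using assms(3)[OF i(1) c x] .
    from less.hyps[OF this c] obtain ii u where
      u: "set ii \<subseteq> I" "u \<in> X" "\<forall>i \<in> I. y i u = None" "apply_seq x ii u = Some c" by blast
    have "apply_seq x (ii @ [i]) u = Some b" using u(4) x by (simp add: apply_seq_append)
    moreover have "set (ii @ [i]) \<subseteq> I" using u(1) i(1) by simp
    ultimately show ?thesis using u(2,3) by blast
  qed
qed

text \<open>Here \<open>e\<close> and \<open>h\<close> are the raising operators inverse to
  \<open>f\<close> and \<open>g\<close>, \<open>cs\<close> stands for the column sizes, kept by
  \<open>f\<close>, and \<open>rs\<close> for the row sizes, kept by \<open>g\<close>. Each
  assumption comes with its mirror image, so exchanging the families gives another instance and
  one-sided results can be transferred.\<close>

locale bicrystal =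
  fixes X :: "'a set" and I :: "'i set" and J :: "'j set"
    and f e :: "'i \<Rightarrow> 'a \<Rightarrow> 'a option" and g h :: "'j \<Rightarrow> 'a \<Rightarrow> 'a option"
    and cs :: "'a \<Rightarrow> 'c" and rs :: "'a \<Rightarrow> 'd" and mf mg :: "'a \<Rightarrow> nat"
  assumes closed: "i \<in> I \<Longrightarrow> closed_under X (f i)" "i \<in> I \<Longrightarrow> closed_under X (e i)"
      "j \<in> J \<Longrightarrow> closed_under X (g j)" "j \<in> J \<Longrightarrow> closed_under X (h j)"
    and inv: "i \<in> I \<Longrightarrow> inverse_ops X (f i) (e i)" "j \<in> J \<Longrightarrow> inverse_ops X (g j) (h j)"
    and comm: "i \<in> I \<Longrightarrow> j \<in> J \<Longrightarrow> commuting X (f i) (g j)" "i \<in> I \<Longrightarrow> j \<in> J \<Longrightarrow> commuting X (e i) (g j)"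
      "i \<in> I \<Longrightarrow> j \<in> J \<Longrightarrow> commuting X (f i) (h j)" "i \<in> I \<Longrightarrow> j \<in> J \<Longrightarrow> commuting X (e i) (h j)"
    and cs_f: "i \<in> I \<Longrightarrow> b \<in> X \<Longrightarrow> f i b = Some c \<Longrightarrow> cs c = cs b"
    and rs_g: "j \<in> J \<Longrightarrow> b \<in> X \<Longrightarrow> g j b = Some c \<Longrightarrow> rs c = rs b"
    and mf: "i \<in> I \<Longrightarrow> b \<in> X \<Longrightarrow> f i b = Some c \<Longrightarrow> mf b < mf c"
    and mg: "j \<in> J \<Longrightarrow> b \<in> X \<Longrightarrow> g j b = Some c \<Longrightarrow> mg b < mg c"
    and source_cs: "u \<in> X \<Longrightarrow> v \<in> X \<Longrightarrow> \<forall>i \<in> I. e i u = None \<and> e i v = None \<Longrightarrow>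
      \<forall>j \<in> J. h j u = None \<and> h j v = None \<Longrightarrow> cs u = cs v \<Longrightarrow> u = v"
    and source_rs: "u \<in> X \<Longrightarrow> v \<in> X \<Longrightarrow> \<forall>i \<in> I. e i u = None \<and> e i v = None \<Longrightarrow>
      \<forall>j \<in> J. h j u = None \<and> h j v = None \<Longrightarrow> rs u = rs v \<Longrightarrow> u = v"
begin

lemma swapped: "bicrystal X J I g h f e rs cs mg mf"
proof (unfold_locales, goal_cases)
  case (13 j b c) then show ?case by (rule mg)
next
  case (14 i b c) then show ?case by (rule mf)
next
  case (15 u v) then show ?case by (intro source_rs) auto
next
  case (16 u v) then show ?case by (intro source_cs) auto
qed (simp_all add: closed inv comm commuting_sym rs_g cs_f)

definition is_source :: "'a \<Rightarrow> bool" where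
  "is_source u \<longleftrightarrow> u \<in> X \<and> (\<forall>i \<in> I. e i u = None) \<and> (\<forall>j \<in> J. h j u = None)"

text \<open>A commutative square with corners u, p, q, b whose opposite sides carry the same word.
  Recording both paths makes the notion symmetric in the families and treats p and q alike.\<close>

definition factors :: "'a \<Rightarrow> 'a \<Rightarrow> 'a \<Rightarrow> 'a \<Rightarrow> 'i list \<Rightarrow> 'j list \<Rightarrow> bool" where
  "factors b u p q ii jj \<longleftrightarrow> is_source u \<and> set ii \<subseteq> I \<and> set jj \<subseteq> J \<and>
     apply_seq f ii u = Some p \<and> apply_seq g jj u = Some q \<and>
     apply_seq g jj p = Some b \<and> apply_seq f ii q = Some b"

lemma seq_closed:
  "set ii \<subseteq> I \<Longrightarrow> closed_under X (apply_seq f ii)" "set ii \<subseteq> I \<Longrightarrow> closed_under X (apply_seq e ii)"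
  "set jj \<subseteq> J \<Longrightarrow> closed_under X (apply_seq g jj)" "set jj \<subseteq> J \<Longrightarrow> closed_under X (apply_seq h jj)"
  using closed by (auto intro!: apply_seq_closed)

lemma seq_in:
  "set ii \<subseteq> I \<Longrightarrow> b \<in> X \<Longrightarrow> apply_seq f ii b = Some c \<Longrightarrow> c \<in> X"
  "set jj \<subseteq> J \<Longrightarrow> b \<in> X \<Longrightarrow> apply_seq g jj b = Some c \<Longrightarrow> c \<in> X"
  using seq_closed unfolding closed_under_def by blast+

lemma seq_comm:
  assumes "set ii \<subseteq> I" "set jj \<subseteq> J"
  shows "commuting X (apply_seq f ii) (apply_seq g jj)" "commuting X (apply_seq e ii) (apply_seq g jj)"
    "commuting X (apply_seq f ii) (apply_seq h jj)" "commuting X (apply_seq e ii) (apply_seq h jj)"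
  using assms closed comm by (intro apply_seq_commuting2; blast)+

lemma seq_inv:
  "set ii \<subseteq> I \<Longrightarrow> b \<in> X \<Longrightarrow> apply_seq f ii b = Some c \<Longrightarrow> apply_seq e (rev ii) c = Some b"
  "set ii \<subseteq> I \<Longrightarrow> b \<in> X \<Longrightarrow> apply_seq e ii b = Some c \<Longrightarrow> apply_seq f (rev ii) c = Some b"
  "set jj \<subseteq> J \<Longrightarrow> b \<in> X \<Longrightarrow> apply_seq g jj b = Some c \<Longrightarrow> apply_seq h (rev jj) c = Some b"
  "set jj \<subseteq> J \<Longrightarrow> b \<in> X \<Longrightarrow> apply_seq h jj b = Some c \<Longrightarrow> apply_seq g (rev jj) c = Some b"
proof -
  have *: "inverse_ops X x y \<Longrightarrow> inverse_ops X y x" for x y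
    by (auto simp: inverse_ops_def)
  show "set ii \<subseteq> I \<Longrightarrow> b \<in> X \<Longrightarrow> apply_seq f ii b = Some c \<Longrightarrow> apply_seq e (rev ii) c = Some b"
    "set ii \<subseteq> I \<Longrightarrow> b \<in> X \<Longrightarrow> apply_seq e ii b = Some c \<Longrightarrow> apply_seq f (rev ii) c = Some b"
    "set jj \<subseteq> J \<Longrightarrow> b \<in> X \<Longrightarrow> apply_seq g jj b = Some c \<Longrightarrow> apply_seq h (rev jj) c = Some b"
    "set jj \<subseteq> J \<Longrightarrow> b \<in> X \<Longrightarrow> apply_seq h jj b = Some c \<Longrightarrow> apply_seq g (rev jj) c = Some b"
    by (rule apply_seq_inverse[where X = X]; use closed inv inv[THEN *] in blast)+
qed

lemma seq_cs: "set ii \<subseteq> I \<Longrightarrow> b \<in> X \<Longrightarrow> apply_seq f ii b = Some c \<Longrightarrow> cs c = cs b"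
proof (induction ii arbitrary: b)
  case (Cons i ii)
  then obtain b' where b': "f i b = Some b'" "apply_seq f ii b' = Some c"
    by (auto simp: bind_eq_Some_conv)
  have i: "i \<in> I" using Cons.prems by simp
  have "b' \<in> X" using closed_underD[OF closed(1)[OF i] Cons.prems(2) b'(1)] .
  then show ?case using Cons cs_f[OF i _ b'(1)] b' by simp
qed simp

lemma seq_rs: "set jj \<subseteq> J \<Longrightarrow> b \<in> X \<Longrightarrow> apply_seq g jj b = Some c \<Longrightarrow> rs c = rs b"
  using bicrystal.seq_cs[OF swapped] .

text \<open>Commutation carries sources for one family along the operators of the other.\<close>

lemma h_source_f_iff:
  assumes "set ii \<subseteq> I" "u \<in> X" "apply_seq f ii u = Some p"
  shows "(\<forall>j \<in> J. h j p = None) \<longleftrightarrow> (\<forall>j \<in> J. h j u = None)"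
  using commuting_None_iff[OF seq_comm(3)[OF assms(1), of "[j]" for j] assms(2,3)]
  unfolding apply_seq_single by simp

lemma e_source_g_iff:
  assumes "set jj \<subseteq> J" "u \<in> X" "apply_seq g jj u = Some q"
  shows "(\<forall>i \<in> I. e i q = None) \<longleftrightarrow> (\<forall>i \<in> I. e i u = None)"
  using bicrystal.h_source_f_iff[OF swapped assms] .

lemma factorsD:
  assumes "factors b u p q ii jj"
  shows "u \<in> X" "p \<in> X" "q \<in> X" "b \<in> X" "cs p = cs u" "rs q = rs u"
    "\<forall>j \<in> J. h j p = None" "\<forall>i \<in> I. e i q = None"
proof -
  have a: "set ii \<subseteq> I" "set jj \<subseteq> J" "apply_seq f ii u = Some p" "apply_seq g jj u = Some q"
    "apply_seq f ii q = Some b" "is_source u"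
    using assms unfolding factors_def by simp_all
  then show u: "u \<in> X" by (simp add: is_source_def)
  show "p \<in> X" by (rule seq_in(1)[OF a(1) u a(3)])
  show q: "q \<in> X" by (rule seq_in(2)[OF a(2) u a(4)])
  show "b \<in> X" by (rule seq_in(1)[OF a(1) q a(5)])
  show "cs p = cs u" by (rule seq_cs[OF a(1) u a(3)])
  show "rs q = rs u" by (rule seq_rs[OF a(2) u a(4)])
  show "\<forall>j \<in> J. h j p = None" using h_source_f_iff[OF a(1) u a(3)] a(6) by (simp add: is_source_def)
  show "\<forall>i \<in> I. e i q = None" using e_source_g_iff[OF a(2) u a(4)] a(6) by (simp add: is_source_def)
qed

text \<open>A factorization only provides the path through p; commutation completes the square and
  produces the corner q.\<close>

lemma factorsI:
  assumes "is_source u" "set ii \<subseteq> I" "set jj \<subseteq> J" "apply_seq f ii u = Some p" "apply_seq g jj p = Some b"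
  shows "\<exists>q. factors b u p q ii jj"
proof -
  have "u \<in> X" using assms(1) by (simp add: is_source_def)
  from commuting_later[OF seq_comm(1)[OF assms(2,3)] this assms(4,5)] show ?thesis
    using assms unfolding factors_def by blast
qed

text \<open>Climbing with \<open>e\<close> alone keeps the element killed by all \<open>h\<close>,
  so the climb ends in a source of both families. It also keeps \<open>cs\<close>, which determines
  that source.\<close>

lemma h_source_reach:
  assumes "p \<in> X" "\<forall>j \<in> J. h j p = None"
  shows "\<exists>ii u. set ii \<subseteq> I \<and> is_source u \<and> apply_seq f ii u = Some p \<and> cs u = cs p"
proof -
  have "\<exists>ii u. set ii \<subseteq> I \<and> u \<in> X \<and> (\<forall>i \<in> I. e i u = None) \<and> apply_seq f ii u = Some p"
    by (rule reach_source[where m = mf]; (erule closed inv | erule (2) mf | rule assms))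
  then obtain ii u where u: "set ii \<subseteq> I" "u \<in> X" "\<forall>i \<in> I. e i u = None" "apply_seq f ii u = Some p"
    by blast
  have "\<forall>j \<in> J. h j u = None" using h_source_f_iff[OF u(1,2,4)] assms(2) by simp
  with u(2,3) have "is_source u" by (simp add: is_source_def)
  moreover have "cs u = cs p" using seq_cs[OF u(1,2,4)] by simp
  ultimately show ?thesis using u(1,4) by blast
qed

lemma e_source_reach:
  assumes "q \<in> X" "\<forall>i \<in> I. e i q = None"
  shows "\<exists>jj u. set jj \<subseteq> J \<and> is_source u \<and> apply_seq g jj u = Some q \<and> rs u = rs q"
proof -
  have "bicrystal.is_source X J I h e u \<longleftrightarrow> is_source u" for u
    unfolding is_source_def bicrystal.is_source_def[OF swapped] by auto
  then show ?thesis using bicrystal.h_source_reach[OF swapped assms] by simp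
qed

text \<open>The climb uses \<open>h\<close> before \<open>e\<close>, so that the path read downwards
  applies \<open>f\<close> before \<open>g\<close>, the order prescribed for a
  factorization.\<close>

lemma factors_exists:
  assumes "b \<in> X"
  shows "\<exists>u p q ii jj. factors b u p q ii jj"
proof -
  have "\<exists>jj p. set jj \<subseteq> J \<and> p \<in> X \<and> (\<forall>j \<in> J. h j p = None) \<and> apply_seq g jj p = Some b"
    by (rule reach_source[where m = mg]; (erule closed inv | erule (2) mg | rule assms))
  then obtain jj p where p: "set jj \<subseteq> J" "p \<in> X" "\<forall>j \<in> J. h j p = None" "apply_seq g jj p = Some b"
    by blast
  obtain ii u where u: "set ii \<subseteq> I" "is_source u" "apply_seq f ii u = Some p"
    using h_source_reach[OF p(2,3)] by blast
  from factorsI[OF u(2,1) p(1) u(3) p(4)] show ?thesis by blast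
qed

lemma source_eqI: "is_source u \<Longrightarrow> is_source v \<Longrightarrow> cs u = cs v \<or> rs u = rs v \<Longrightarrow> u = v"
  unfolding is_source_def by (elim disjE) (rule source_cs source_rs; simp)+

text \<open>Follow from \<open>b\<close> the raising operators of the first factorization in one family and those of
  the second in the other: the result \<open>w\<close> is a source with the \<open>cs\<close> of \<open>u\<close> and the \<open>rs\<close> of \<open>u'\<close>.\<close>

lemma factors_unique:
  assumes "factors b u p q ii jj" "factors b u' p' q' ii' jj'"
  shows "u' = u \<and> p' = p \<and> q' = q"
proof -
  have a: "is_source u" "set jj \<subseteq> J" "apply_seq g jj p = Some b" "apply_seq f ii' u' = Some p'"
    "apply_seq g jj u = Some q"
    and a': "is_source u'" "set ii' \<subseteq> I" "apply_seq f ii' q' = Some b"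
    using assms unfolding factors_def by simp_all
  note X = factorsD(1-4)[OF assms(1)] and X' = factorsD(1-4)[OF assms(2)]
  have r: "set (rev ii') \<subseteq> I" "set (rev jj) \<subseteq> J" using a(2) a'(2) by simp_all
  have q': "apply_seq e (rev ii') b = Some q'" by (rule seq_inv(1)[OF a'(2) X'(3) a'(3)])
  have p: "apply_seq h (rev jj) b = Some p" by (rule seq_inv(3)[OF a(2) X(2) a(3)])
  obtain w where w: "apply_seq h (rev jj) q' = Some w" "apply_seq e (rev ii') p = Some w"
    using commuting_both[OF seq_comm(4)[OF r] X(4) q' p] by blast
  have wX: "w \<in> X" using closed_underD[OF seq_closed(4)[OF r(2)] X'(3) w(1)] .
  have fw: "apply_seq f ii' w = Some p" using seq_inv(2)[OF r(1) X(2) w(2)] by simp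
  have gw: "apply_seq g jj w = Some q'" using seq_inv(4)[OF r(2) X'(3) w(1)] by simp
  have "\<forall>j \<in> J. h j w = None"
    using h_source_f_iff[OF a'(2) wX fw] factorsD(7)[OF assms(1)] by simp
  moreover have "\<forall>i \<in> I. e i w = None"
    using e_source_g_iff[OF a(2) wX gw] factorsD(8)[OF assms(2)] by simp
  ultimately have sw: "is_source w" using wX by (simp add: is_source_def)
  have "cs w = cs u" using seq_cs[OF a'(2) wX fw] factorsD(5)[OF assms(1)] by simp
  then have "w = u" using source_eqI[OF sw a(1)] by simp
  moreover have "rs w = rs u'" using seq_rs[OF a(2) wX gw] factorsD(6)[OF assms(2)] by simp
  then have "w = u'" using source_eqI[OF sw a'(1)] by simp
  ultimately show ?thesis using a(4,5) fw gw by simp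
qed

lemma factors_swap: "bicrystal.factors X J I g h f e b u q p jj ii \<longleftrightarrow> factors b u p q ii jj"
  unfolding factors_def bicrystal.factors_def[OF swapped] is_source_def
    bicrystal.is_source_def[OF swapped] by auto

text \<open>Equivariance of the corner p, with q and u unchanged. The word \<open>ii'\<close> cannot
  simply be derived from \<open>ii\<close>, since a raising operator need not undo its last letter.
  Instead p' is climbed afresh, and the source reached is recognized as u by its
  \<open>cs\<close>.\<close>

lemma factors_f_step:
  assumes "factors b u p q ii jj" "i \<in> I" "x = f i \<or> x = e i"
  shows "(x b = None \<longrightarrow> x p = None) \<and>
    (\<forall>b'. x b = Some b' \<longrightarrow> (\<exists>p' ii'. x p = Some p' \<and> factors b' u p' q ii' jj))"
proof -
  have a: "is_source u" "set jj \<subseteq> J" "apply_seq g jj p = Some b" "apply_seq g jj u = Some q"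
    using assms(1) unfolding factors_def by simp_all
  note X = factorsD(1-4)[OF assms(1)]
  have s: "set [i] \<subseteq> I" using assms(2) by simp
  have c: "commuting X (apply_seq g jj) x"
    using commuting_sym[OF seq_comm(1)[OF s a(2)]] commuting_sym[OF seq_comm(2)[OF s a(2)]] assms(3)
    unfolding apply_seq_single by auto
  have "\<exists>p' ii'. x p = Some p' \<and> factors b' u p' q ii' jj" if b': "x b = Some b'" for b'
  proof -
    obtain p' where p': "x p = Some p'" "apply_seq g jj p' = Some b'"
      using commuting_later[OF c X(2) a(3) b'] by blast
    have "closed_under X x" using closed(1,2)[OF assms(2)] assms(3) by auto
    from closed_underD[OF this X(2) p'(1)] have p'X: "p' \<in> X" .
    \<comment> \<open>For \<open>x = e i\<close> the arrow is reversed, so in both cases p and p'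
      are joined by one step of \<open>f\<close>, along which \<open>cs\<close> and the vanishing of
      all \<open>h\<close> are known to be transported.\<close>
    have "apply_seq f [i] p = Some p' \<or> apply_seq f [i] p' = Some p"
      using assms(3) p'(1) inverse_opsD[OF inv(1)[OF assms(2)] p'X X(2)]
      unfolding apply_seq_single by auto
    then have "(\<forall>j \<in> J. h j p' = None) \<and> cs p' = cs p"
    proof
      assume *: "apply_seq f [i] p = Some p'"
      show ?thesis
        using h_source_f_iff[OF s X(2) *] seq_cs[OF s X(2) *] factorsD(7)[OF assms(1)] by simp
    next
      assume *: "apply_seq f [i] p' = Some p"
      show ?thesis
        using h_source_f_iff[OF s p'X *] seq_cs[OF s p'X *] factorsD(7)[OF assms(1)] by simp
    qed
    then obtain ii' v where v: "set ii' \<subseteq> I" "is_source v" "apply_seq f ii' v = Some p'" "cs v = cs u"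
      using h_source_reach[OF p'X] factorsD(5)[OF assms(1)] by auto
    have "v = u" using source_eqI[OF v(2) a(1)] v(4) by simp
    obtain q' where q': "factors b' v p' q' ii' jj"
      using factorsI[OF v(2,1) a(2) v(3) p'(2)] by blast
    then have "q' = q" using a(4) \<open>v = u\<close> unfolding factors_def by simp
    with p' q' \<open>v = u\<close> show ?thesis by blast
  qed
  moreover have "x b = None \<longrightarrow> x p = None" using commuting_None_iff[OF c X(2) a(3)] by simp
  ultimately show ?thesis by blast
qed

lemma factors_g_step:
  assumes "factors b u p q ii jj" "j \<in> J" "x = g j \<or> x = h j"
  shows "(x b = None \<longrightarrow> x q = None) \<and>
    (\<forall>b'. x b = Some b' \<longrightarrow> (\<exists>q' jj'. x q = Some q' \<and> factors b' u p q' ii jj'))"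
  using bicrystal.factors_f_step[OF swapped, unfolded factors_swap, OF assms] .

text \<open>The corner p determines u through \<open>cs\<close>. Then b and b' are both the fourth
  corner over u, p, q, completed with \<open>ii'\<close> from one square and \<open>jj\<close> from
  the other.\<close>

lemma factors_inj:
  assumes "factors b u p q ii jj" "factors b' u' p q ii' jj'"
  shows "b' = b"
proof -
  have a: "is_source u" "set jj \<subseteq> J" "apply_seq g jj u = Some q" "apply_seq g jj p = Some b"
    and a': "is_source u'" "set ii' \<subseteq> I" "apply_seq f ii' u' = Some p" "apply_seq f ii' q = Some b'"
    using assms unfolding factors_def by simp_all
  have "u' = u"
    using source_eqI[OF a'(1) a(1)] factorsD(5)[OF assms(1)] factorsD(5)[OF assms(2)] by simp
  have "u \<in> X" using a(1) by (simp add: is_source_def)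
  from commuting_both[OF seq_comm(1)[OF a'(2) a(2)] this a'(3)[unfolded \<open>u' = u\<close>] a(3)]
  show ?thesis using a(4) a'(4) by simp
qed

end


section \<open>Sources: tableaux, antitableaux and Yamanouchi words\<close>

lemma sum_list_col_sign:
  assumes "distinct ps"
  shows "sum_list (map (col_sign k c) ps) = int (card (dual c k \<inter> set ps)) - int (card (dual c (Suc k) \<inter> set ps))"
  using assms
proof (induction ps)
  case (Cons p ps)
  have "p \<notin> dual c k \<inter> set ps" "p \<notin> dual c (Suc k) \<inter> set ps" using Cons.prems by auto
  then show ?case using Cons by (simp add: Int_insert_right col_sign_def)
qed simp

lemma minus_count_sg_eq_0_iff:
  assumes "distinct ps"
  shows "minus_count (col_sign k c) ps = 0 \<longleftrightarrow>
    (\<forall>t. card (dual c (Suc k) \<inter> set (take t ps)) \<le> card (dual c k \<inter> set (take t ps)))"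
proof -
  have "minus_count (col_sign k c) ps = 0 \<longleftrightarrow> (\<forall>t. 0 \<le> sum_list (map (col_sign k c) (take t ps)))"
    by (rule minus_count_eq_0_iff) (rule col_sign_values)
  then show ?thesis by (simp add: sum_list_col_sign[OF distinct_take[OF assms]])
qed

lemma minus_count_orderFdot_eq_0_iff:
  assumes "dual c k \<subseteq> {1..n}" "dual c (Suc k) \<subseteq> {1..n}"
  shows "minus_count (col_sign k c) (orderFdot n) = 0 \<longleftrightarrow> (\<forall>m. card (dual c (Suc k) \<inter> {..m}) \<le> card (dual c k \<inter> {..m}))"
proof -
  have "A \<inter> set (take t (orderFdot n)) = A \<inter> {..t}" if "A \<subseteq> {1..n}" for A t
  proof -
    have "set (take t (orderFdot n)) = {1..n} \<inter> {..t}"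
      by (cases "t \<le> n") (auto simp: orderFdot_def take_upt simp del: upt_Suc)
    then show ?thesis using that by auto
  qed
  then show ?thesis unfolding minus_count_sg_eq_0_iff[OF distinct_orders(2)] using assms by simp
qed

text \<open>Columns are read from l downwards, so prefixes of the order are final segments of
  positions. This is the source of the bottom alignment on the dual side, whereas initial segments
  in the lemma before lead to the top alignment.\<close>

lemma minus_count_orderF_eq_0_iff:
  assumes "dual c k \<subseteq> {1..l}" "dual c (Suc k) \<subseteq> {1..l}"
  shows "minus_count (col_sign k c) (orderF l) = 0 \<longleftrightarrow> (\<forall>m. card (dual c (Suc k) \<inter> {m..}) \<le> card (dual c k \<inter> {m..}))"
proof -
  have *: "A \<inter> set (take t (orderF l)) = A \<inter> {Suc l - t..}" if "A \<subseteq> {1..l}" for A t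
  proof -
    have "take t (orderF l) = rev (drop (l - t) [1..<Suc l])"
      unfolding orderF_def by (simp add: take_rev)
    also have "drop (l - t) [1..<Suc l] = [1 + (l - t)..<Suc l]" by (rule drop_upt)
    finally have t: "set (take t (orderF l)) = {1 + (l - t)..<Suc l}" by (simp del: upt_Suc)
    show ?thesis
    proof (rule set_eqI)
      fix x
      have "x \<in> A \<Longrightarrow> 1 \<le> x \<and> x \<le> l" using that by auto
      then show "x \<in> A \<inter> set (take t (orderF l)) \<longleftrightarrow> x \<in> A \<inter> {Suc l - t..}"
        unfolding t by auto
    qed
  qed
  \<comment> \<open>The truncated difference takes only values up to \<open>Suc l\<close>; for
    thresholds above l the inequality holds because its left side counts an empty set.\<close>
  have all: "(\<forall>t. Q (Suc l - t)) \<longleftrightarrow> (\<forall>m. Q m)"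
    if big: "\<And>m. m > l \<Longrightarrow> Q m" for Q
  proof (intro iffI allI)
    fix m assume a: "\<forall>t. Q (Suc l - t)"
    show "Q m"
    proof (cases "m \<le> l")
      case True
      then show ?thesis using a[rule_format, of "Suc l - m"] by simp
    qed (use big in simp)
  qed simp
  have "dual c (Suc k) \<inter> {m..} = {}" if "m > l" for m
    using that assms(2) by fastforce
  then have "(\<forall>t. card (dual c (Suc k) \<inter> {Suc l - t..}) \<le> card (dual c k \<inter> {Suc l - t..})) \<longleftrightarrow>
    (\<forall>m. card (dual c (Suc k) \<inter> {m..}) \<le> card (dual c k \<inter> {m..}))"
    by (intro all) simp
  then show ?thesis unfolding minus_count_sg_eq_0_iff[OF distinct_orders(1)]
    unfolding *[OF assms(1)] *[OF assms(2)] .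
qed

section \<open>Semistandard columns as inequalities between counting functions\<close>

lemma sorted_nth_iff:
  assumes "sorted_wrt le xs" "\<And>x y. le x y \<Longrightarrow> P y \<Longrightarrow> P x" "r < length xs"
  shows "P (xs ! r) \<longleftrightarrow> r < length (filter P xs)"
  using assms(1,3)
proof (induction xs arbitrary: r)
  case (Cons x xs)
  show ?case
  proof (cases "P x")
    case True
    then show ?thesis using Cons by (cases r) auto
  next
    case False
    then have "\<forall>y \<in> set xs. \<not> P y" using Cons.prems assms(2) by auto
    then have "\<forall>y \<in> set (x # xs). \<not> P y" using False by simp
    then have "filter P (x # xs) = []" "\<not> P ((x # xs) ! r)"
      using nth_mem[OF Cons.prems(2)] by (simp only: filter_empty_conv, blast)
    then show ?thesis by simp
  qed
qed simp

text \<open>In a sorted list the elements below a threshold fill an initial segment, so comparing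
  entries at equal positions amounts to comparing these counts. The order is a parameter because
  bottom-aligned columns are read backwards and need \<open>(\<ge>)\<close>.\<close>

lemma sorted_pointwise_iff:
  assumes "sorted_wrt le xs" "sorted_wrt le ys" "reflp le" "transp le"
  shows "(length ys \<le> length xs \<and> (\<forall>r < length ys. le (xs ! r) (ys ! r))) \<longleftrightarrow>
    (length ys \<le> length xs \<and> (\<forall>m. length (filter (\<lambda>y. le y m) ys) \<le> length (filter (\<lambda>x. le x m) xs)))"
proof -
  have down: "le x y \<Longrightarrow> le y m \<Longrightarrow> le x m" for x y m
    using assms(4) by (rule transpD)
  have nth: "le (zs ! r) m \<longleftrightarrow> r < length (filter (\<lambda>x. le x m) zs)"
    if "sorted_wrt le zs" "r < length zs" for zs r m
    by (rule sorted_nth_iff[OF that(1) down that(2)])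
  show ?thesis
  proof (intro conj_cong refl iffI allI impI)
    fix m assume len: "length ys \<le> length xs" and le: "\<forall>r < length ys. le (xs ! r) (ys ! r)"
    show "length (filter (\<lambda>y. le y m) ys) \<le> length (filter (\<lambda>x. le x m) xs)"
    proof (cases "length (filter (\<lambda>y. le y m) ys)")
      case (Suc r)
      then have r: "r < length ys" using length_filter_le[of "\<lambda>y. le y m" ys] by simp
      have "le (ys ! r) m" using nth[OF assms(2) r, of m] Suc by simp
      then have "le (xs ! r) m" using le r down by blast
      then show ?thesis using nth[OF assms(1), of r m] r len Suc by simp
    qed simp
  next
    fix r assume len: "length ys \<le> length xs" and r: "r < length ys"
      and le: "\<forall>m. length (filter (\<lambda>y. le y m) ys) \<le> length (filter (\<lambda>x. le x m) xs)"
    have "le (ys ! r) (ys ! r)" using assms(3) by (simp add: reflp_def)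
    then have "r < length (filter (\<lambda>y. le y (ys ! r)) ys)"
      using nth[OF assms(2) r, of "ys ! r"] by simp
    also have "\<dots> \<le> length (filter (\<lambda>x. le x (ys ! r)) xs)" using le by blast
    finally show "le (xs ! r) (ys ! r)"
      using nth[OF assms(1), of r "ys ! r"] r len by simp
  qed
qed

lemma length_filter_sorted:
  fixes A :: "nat set"
  assumes "finite A"
  shows "length (filter P (sorted_list_of_set A)) = card (A \<inter> {x. P x})"
  using assms by (simp add: filter_sorted_list_of_set Collect_conj_eq)

lemma top_pair_iff:
  fixes A B :: "nat set"
  assumes "finite A" "finite B"
  shows "card B \<le> card A \<and> (\<forall>r < card B. sorted_list_of_set A ! r \<le> sorted_list_of_set B ! r) \<longleftrightarrow>
    (\<forall>m. card (B \<inter> {..m}) \<le> card (A \<inter> {..m}))"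
proof -
  have "card B \<le> card A" if *: "\<forall>m. card (B \<inter> {..m}) \<le> card (A \<inter> {..m})"
  proof -
    \<comment> \<open>A threshold above all of \<open>B\<close> turns the inequality into the
      comparison of heights; inserting 0 covers the empty column.\<close>
    have "B \<inter> {..Max (insert 0 B)} = B" using assms(2) by auto
    then have "card B \<le> card (A \<inter> {..Max (insert 0 B)})" using *[rule_format, of "Max (insert 0 B)"] by simp
    also have "\<dots> \<le> card A" using assms(1) by (intro card_mono) auto
    finally show ?thesis .
  qed
  moreover have "reflp ((\<le>) :: nat \<Rightarrow> nat \<Rightarrow> bool)" "transp ((\<le>) :: nat \<Rightarrow> nat \<Rightarrow> bool)"
    by (auto simp: reflp_def transp_def)
  ultimately show ?thesis
    using sorted_pointwise_iff[of "(\<le>)" "sorted_list_of_set A" "sorted_list_of_set B"] assms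
    by (auto simp: length_filter_sorted atMost_def)
qed

lemma bottom_pair_iff:
  fixes A B :: "nat set"
  assumes "finite A" "finite B"
  shows "card A \<le> card B \<and> (\<forall>r < card A. rev (sorted_list_of_set A) ! r \<le> rev (sorted_list_of_set B) ! r) \<longleftrightarrow>
    (\<forall>m. card (A \<inter> {m..}) \<le> card (B \<inter> {m..}))"
proof -
  have "card A \<le> card B" if *: "\<forall>m. card (A \<inter> {m..}) \<le> card (B \<inter> {m..})"
    using *[rule_format, of 0] by simp
  moreover have "reflp ((\<ge>) :: nat \<Rightarrow> nat \<Rightarrow> bool)" "transp ((\<ge>) :: nat \<Rightarrow> nat \<Rightarrow> bool)"
    by (auto simp: reflp_def transp_def)
  moreover have "sorted_wrt (\<ge>) (rev (sorted_list_of_set C))" for C :: "nat set"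
    by (simp add: sorted_wrt_rev)
  ultimately show ?thesis
    using sorted_pointwise_iff[of "(\<ge>)" "rev (sorted_list_of_set B)" "rev (sorted_list_of_set A)"] assms
    by (auto simp: length_filter_sorted atLeast_def rev_filter[symmetric])
qed

lemma sorted_wrt_upt_iff:
  assumes "transp R"
  shows "sorted_wrt R [1..<Suc q] \<longleftrightarrow> (\<forall>k \<in> {1..<q}. R k (Suc k))"
proof -
  have "sorted_wrt R [1..<Suc q] \<longleftrightarrow> (\<forall>i. Suc i < q \<longrightarrow> R (Suc i) (Suc (Suc i)))"
    unfolding sorted_wrt_iff_nth_Suc_transp[OF assms] by (auto simp del: upt_Suc)
  also have "\<dots> \<longleftrightarrow> (\<forall>k \<in> {1..<q}. R k (Suc k))"
  proof
    assume a: "\<forall>i. Suc i < q \<longrightarrow> R (Suc i) (Suc (Suc i))"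
    show "\<forall>k \<in> {1..<q}. R k (Suc k)"
    proof
      fix k assume "k \<in> {1..<q}"
      then show "R k (Suc k)" using a[rule_format, of "k - 1"] by simp
    qed
  qed simp
  finally show ?thesis .
qed

lemma configsD:
  assumes "c \<in> configs m q s"
  shows "c p \<subseteq> {1..m}" "p \<notin> {1..q} \<Longrightarrow> c p = {}" "finite (c p)" "dual c i \<subseteq> {1..q}"
    "i \<notin> {1..m} \<Longrightarrow> dual c i = {}" "finite (dual c i)"
proof -
  show 1: "c p \<subseteq> {1..m}" for p using assms by (simp add: configs_def)
  show 2: "p \<notin> {1..q} \<Longrightarrow> c p = {}" for p using assms by (simp add: configs_def)
  show "finite (c p)" using 1 finite_subset by blast
  show 3: "dual c i \<subseteq> {1..q}" using 2 by (force simp: dual_def)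
  show "i \<notin> {1..m} \<Longrightarrow> dual c i = {}" using 1 by (force simp: dual_def)
  show "finite (dual c i)" using 3 finite_subset by blast
qed

lemma configs_finite: "c \<in> configs m q s \<Longrightarrow> \<forall>p. finite (c p)"
  using configsD(3) by blast

lemma sum_of_bool_card:
  assumes "finite A"
  shows "(\<Sum>x \<in> A. of_bool (P x)) = card {x \<in> A. P x}"
  using assms by (simp add: of_bool_def sum.If_cases Collect_conj_eq Int_commute)

lemma dual_configs:
  assumes "c \<in> configs m q s"
  shows "dual c \<in> configs q m s"
proof -
  note c = configsD[OF assms]
  have "(\<Sum>i = 1..m. card (dual c i)) = (\<Sum>i = 1..m. \<Sum>p = 1..q. of_bool (i \<in> c p))"
  proof (rule sum.cong[OF refl])
    fix i
    have "dual c i = {p \<in> {1..q}. i \<in> c p}" using c(4)[of i] by (auto simp: dual_def)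
    then show "card (dual c i) = (\<Sum>p = 1..q. of_bool (i \<in> c p))"
      by (simp only: sum_of_bool_card[OF finite_atLeastAtMost])
  qed
  also have "\<dots> = (\<Sum>p = 1..q. \<Sum>i = 1..m. of_bool (i \<in> c p))" by (rule sum.swap)
  also have "\<dots> = (\<Sum>p = 1..q. card (c p))"
  proof (rule sum.cong[OF refl])
    fix p
    have "{i \<in> {1..m}. i \<in> c p} = c p" using c(1)[of p] by auto
    then show "(\<Sum>i = 1..m. of_bool (i \<in> c p)) = card (c p)"
      by (simp only: sum_of_bool_card[OF finite_atLeastAtMost])
  qed
  also have "\<dots> = s" using assms by (simp add: configs_def)
  finally show ?thesis using c by (simp add: configs_def)
qed

lemma tableau_pairs:
  assumes "b \<in> configs n l s"
  shows "tableau l b \<longleftrightarrow> sorted_wrt (\<lambda>j j'. \<forall>m. card (b j' \<inter> {..m}) \<le> card (b j \<inter> {..m})) [1..<Suc l]"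
  unfolding tableau_def top_ssyt_def sorted_wrt_map top_pair_iff[OF configsD(3)[OF assms] configsD(3)[OF assms]] ..

text \<open>The counting inequality is transitive, so only neighbouring columns matter. For the
  columns j and j + 1 it says exactly that the bracket rule for j on the dual leaves no unmatched
  -.\<close>

lemma tableau_iff:
  assumes "b \<in> configs n l s"
  shows "tableau l b \<longleftrightarrow> (\<forall>j \<in> {1..<l}. raise_op (orderFdot n) j (dual b) = None)"
proof -
  have "tableau l b \<longleftrightarrow> (\<forall>j \<in> {1..<l}. \<forall>m. card (b (Suc j) \<inter> {..m}) \<le> card (b j \<inter> {..m}))"
    unfolding tableau_pairs[OF assms]
    by (rule sorted_wrt_upt_iff) (auto simp: transp_def intro: le_trans)
  also have "\<dots> \<longleftrightarrow> (\<forall>j \<in> {1..<l}. raise_op (orderFdot n) j (dual b) = None)"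
    using minus_count_orderFdot_eq_0_iff[of "dual b" _ n] configsD(1)[OF assms]
      raise_op_None_iff[of "dual b" "orderFdot n"] configs_finite[OF dual_configs[OF assms]] by simp
  finally show ?thesis .
qed

lemma antitableau_pairs:
  assumes "b \<in> configs n l s"
  shows "antitableau_dot n (dual b) \<longleftrightarrow>
    sorted_wrt (\<lambda>i i'. \<forall>m. card (dual b i' \<inter> {m..}) \<le> card (dual b i \<inter> {m..})) [1..<Suc n]"
  unfolding antitableau_dot_def bottom_ssyt_def sorted_wrt_map rev_map[symmetric] sorted_wrt_rev
    bottom_pair_iff[OF configsD(6)[OF assms] configsD(6)[OF assms]] ..

lemma antitableau_iff:
  assumes "b \<in> configs n l s"
  shows "antitableau_dot n (dual b) \<longleftrightarrow> (\<forall>i \<in> {1..<n}. raise_op (orderF l) i b = None)"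
proof -
  have "antitableau_dot n (dual b) \<longleftrightarrow>
      (\<forall>i \<in> {1..<n}. \<forall>m. card (dual b (Suc i) \<inter> {m..}) \<le> card (dual b i \<inter> {m..}))"
    unfolding antitableau_pairs[OF assms]
    by (rule sorted_wrt_upt_iff) (auto simp: transp_def intro: le_trans)
  also have "\<dots> \<longleftrightarrow> (\<forall>i \<in> {1..<n}. raise_op (orderF l) i b = None)"
    using minus_count_orderF_eq_0_iff[of b _ l] configsD(4)[OF assms]
      raise_op_None_iff[of b "orderF l"] configs_finite[OF assms] by simp
  finally show ?thesis .
qed

lemma minus_count_filter: "(\<And>x. \<not> P x \<Longrightarrow> \<sigma> x = 0) \<Longrightarrow> minus_count \<sigma> (filter P xs) = minus_count \<sigma> xs"
  by (induction xs) auto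

lemma minus_count_map: "minus_count \<sigma> (map f xs) = minus_count (\<lambda>x. \<sigma> (f x)) xs"
  by (induction xs) auto

lemma minus_count_reading_word:
  assumes "\<forall>p. finite (c p)"
  shows "minus_count (letter_sign k) (reading_word ps c) = minus_count (col_sign k c) ps"
proof -
  have "minus_count (letter_sign k) (reading_word ps c) = minus_count (psign k) (reading ps c)"
    unfolding reading_word_def minus_count_map psign_def ..
  also have "\<dots> = minus_count (psign k) (filter (\<lambda>(p, x). x = k \<or> x = Suc k) (reading ps c))"
    by (rule minus_count_filter[symmetric]) (auto simp: psign_def letter_sign_def)
  finally show ?thesis using bracket_reading[OF assms, of k ps] by simp
qed

lemma sum_list_letter_sign:
  "sum_list (map (letter_sign k) w) = int (count_list w k) - int (count_list w (Suc k))"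
  by (induction w) (auto simp: letter_sign_def)

lemma yamanouchi_neg: "yamanouchi w \<longleftrightarrow> (\<forall>k \<ge> 1. minus_count (letter_sign k) w = 0)"
proof -
  have "minus_count (letter_sign k) w = 0 \<longleftrightarrow> (\<forall>m. count_list (take m w) (Suc k) \<le> count_list (take m w) k)" for k
  proof -
    have "minus_count (letter_sign k) w = 0 \<longleftrightarrow> (\<forall>t. 0 \<le> sum_list (map (letter_sign k) (take t w)))"
      by (rule minus_count_eq_0_iff) (simp add: letter_sign_def)
    then show ?thesis by (simp add: sum_list_letter_sign)
  qed
  then show ?thesis unfolding yamanouchi_def by blast
qed

text \<open>For k from n on, the letter k + 1 does not occur and the prefix condition is automatic.
  Together with \<open>antitableau_iff\<close> this identifies the Yamanouchi property of b with its
  dual being an antitableau.\<close>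

lemma yamanouchi_iff:
  assumes "b \<in> configs n l s"
  shows "yamanouchi (reading_word (orderF l) b) \<longleftrightarrow> (\<forall>i \<in> {1..<n}. raise_op (orderF l) i b = None)"
proof -
  have "minus_count (col_sign k b) (orderF l) = 0" if "k \<ge> n" for k
  proof -
    have "dual b (Suc k) = {}" using configsD(5)[OF assms] that by simp
    then show ?thesis by (simp add: minus_count_sg_eq_0_iff)
  qed
  then have "(\<forall>k \<ge> 1. minus_count (col_sign k b) (orderF l) = 0) \<longleftrightarrow> (\<forall>i \<in> {1..<n}. minus_count (col_sign i b) (orderF l) = 0)"
    by (metis atLeastLessThan_iff not_le)
  then show ?thesis
    unfolding yamanouchi_neg minus_count_reading_word[OF configs_finite[OF assms]]
      raise_op_None_iff[OF configs_finite[OF assms]] .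
qed


section \<open>Shapes\<close>

lemma sorted_wrt_uptD:
  assumes "sorted_wrt R [1..<Suc q]" "1 \<le> i" "i < j" "j \<le> q"
  shows "R i j"
  using sorted_wrt_nth_less[OF assms(1), of "i - 1" "j - 1"] assms(2-4) by (simp del: upt_Suc)

lemma initial_segment:
  fixes A :: "nat set"
  assumes "finite A" "0 \<notin> A" "\<And>i. 1 \<le> i \<Longrightarrow> Suc i \<in> A \<Longrightarrow> i \<in> A"
  shows "A = {1..card A}"
proof (cases "A = {}")
  case False
  have down: "i \<in> A" if "1 \<le> i" "i \<le> Max A" for i
    using that(2,1)
  proof (induction rule: inc_induct)
    case base
    show ?case by (rule Max_in[OF assms(1) False])
  next
    case (step k)
    then show ?case using assms(3)[of k] by simp
  qed
  have "A = {1..Max A}"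
  proof (intro equalityI subsetI)
    fix x assume x: "x \<in> A"
    then have "x \<noteq> 0" using assms(2) by metis
    then show "x \<in> {1..Max A}" using Max_ge[OF assms(1) x] by simp
  next
    fix x assume "x \<in> {1..Max A}"
    then show "x \<in> A" using down[of x] by simp
  qed
  moreover from this have "card A = Max A" by (metis card_atLeastAtMost diff_Suc_1)
  ultimately show ?thesis by simp
qed simp

text \<open>Induction from column l downwards. Suppose column j contains i + 1 but not i. If i
  occurs in a later column, that column is an initial segment by induction and has i letters up to
  i, while column j has fewer, against the tableau condition. If i occurs in no column from j on,
  then i + 1 outnumbers i among these columns, against the antitableau condition.\<close>

lemma source_columns:
  assumes "b \<in> configs n l s" "tableau l b" "antitableau_dot n (dual b)"
  shows "b j = {1..card (b j)}"
proof -
  note c = configsD[OF assms(1)]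
  have T: "card (b j' \<inter> {..m}) \<le> card (b j \<inter> {..m})" if "1 \<le> j" "j < j'" "j' \<le> l" for j j' m
    using sorted_wrt_uptD[OF assms(2)[unfolded tableau_pairs[OF assms(1)]] that] by blast
  have Y: "card (dual b i' \<inter> {m..}) \<le> card (dual b i \<inter> {m..})" if "1 \<le> i" "i < i'" "i' \<le> n" for i i' m
    using sorted_wrt_uptD[OF assms(3)[unfolded antitableau_pairs[OF assms(1)]] that] by blast
  have segment: "b j = {1..card (b j)}" if "\<And>i. 1 \<le> i \<Longrightarrow> Suc i \<in> b j \<Longrightarrow> i \<in> b j" for j
  proof (rule initial_segment[OF c(3) _ that])
    show "0 \<notin> b j" using c(1)[of j] by auto
  qed
  have "i \<in> b j" if "1 \<le> i" "Suc i \<in> b j" for i j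
    using that
  proof (induction "l - j" arbitrary: i j rule: less_induct)
    case less
    have j: "1 \<le> j" "j \<le> l" using c(2)[of j] less.prems by force+
    have i: "Suc i \<le> n" using c(1)[of j] less.prems by auto
    show ?case
    proof (rule ccontr)
      assume no: "i \<notin> b j"
      show False
      proof (cases "\<exists>j' > j. i \<in> b j'")
        case True
        then obtain j' where j': "j < j'" "i \<in> b j'" by blast
        have "j' \<le> l" using c(2)[of j'] j' by force
        have "l - j' < l - j" using j'(1) \<open>j' \<le> l\<close> by simp
        from segment[OF less.hyps[OF this]] have seg: "b j' = {1..card (b j')}" .
        then have "i \<le> card (b j')" using j'(2) by (metis atLeastAtMost_iff)
        then have "b j' \<inter> {..i} = {1..i}" by (subst seg) auto
        then have "i = card (b j' \<inter> {..i})" by simp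
        also have "\<dots> \<le> card (b j \<inter> {..i})" using T[OF j(1) j'(1) \<open>j' \<le> l\<close>] .
        also have "\<dots> \<le> card {1..<i}"
        proof (rule card_mono)
          show "b j \<inter> {..i} \<subseteq> {1..<i}"
          proof
            fix x assume "x \<in> b j \<inter> {..i}"
            then show "x \<in> {1..<i}" using no c(1)[of j] by (cases "x = i") auto
          qed
        qed simp
        finally show False using less.prems(1) by simp
      next
        case False
        then have "dual b i \<inter> {j..} = {}" using no by (auto simp: le_less)
        moreover have "j \<in> dual b (Suc i) \<inter> {j..}" using less.prems by simp
        then have "card (dual b (Suc i) \<inter> {j..}) > 0"
          using c(6)[of "Suc i"] unfolding card_gt_0_iff by blast
        ultimately show False using Y[of i "Suc i" j] less.prems(1) i by simp
      qed
    qed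
  qed
  then show ?thesis by (rule segment)
qed

lemma source_rows:
  assumes "b \<in> configs n l s" "tableau l b" "antitableau_dot n (dual b)"
  shows "dual b i = {1..card (dual b i)}"
proof (rule initial_segment)
  note c = configsD[OF assms(1)]
  show "finite (dual b i)" by (rule c(6))
  show "0 \<notin> dual b i" using c(4)[of i] by auto
  fix j assume j: "1 \<le> j" "Suc j \<in> dual b i"
  then have "Suc j \<le> l" using c(4)[of i] by auto
  have "card (b (Suc j)) \<le> card (b j)"
    using sorted_wrt_uptD[OF assms(2)[unfolded tableau_def top_ssyt_def sorted_wrt_map] j(1) lessI \<open>Suc j \<le> l\<close>]
    by simp
  moreover have "i \<in> b (Suc j)" using j by simp
  ultimately have "i \<in> {1..card (b j)}"
    using source_columns[OF assms, of "Suc j"] by (metis atLeastAtMost_iff le_trans)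
  then have "i \<in> b j" using source_columns[OF assms, of j] by metis
  then show "j \<in> dual b i" by simp
qed

text \<open>The count for r is nonzero up to the largest entry and 0 beyond it, so removing zeros
  makes the bound irrelevant. With the bound n, the counts are indexed by the rows of a
  configuration.\<close>

lemma conj_part_eq_filter:
  assumes "\<And>x. x \<in> set xs \<Longrightarrow> x \<le> N"
  shows "conj_part xs = filter (\<lambda>x. x \<noteq> 0) (map (\<lambda>r. length (filter (\<lambda>x. r \<le> x) xs)) [1..<Suc N])"
proof -
  define M where "M = Max (insert 0 (set xs))"
  define c where "c r = length (filter (\<lambda>x. r \<le> x) xs)" for r
  have "M \<le> N" using assms by (simp add: M_def)
  then have split: "[1..<Suc N] = [1..<Suc M] @ [Suc M..<Suc N]"
    using upt_add_eq_append[of 1 "Suc M" "N - M"] by simp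
  have "c r \<noteq> 0" if "r \<in> set [1..<Suc M]" for r
  proof -
    have "M \<in> insert 0 (set xs)" unfolding M_def by (rule Max_in) auto
    then have "M \<in> set xs" "r \<le> M" using that by auto
    then have "filter (\<lambda>x. r \<le> x) xs \<noteq> []" by (auto simp: filter_empty_conv)
    then show ?thesis by (simp add: c_def)
  qed
  then have 1: "filter (\<lambda>x. x \<noteq> 0) (map c [1..<Suc M]) = map c [1..<Suc M]"
    by (auto simp: filter_id_conv simp del: upt_Suc)
  have "c r = 0" if "r \<in> set [Suc M..<Suc N]" for r
  proof -
    have "x \<le> M" if "x \<in> set xs" for x using that by (simp add: M_def)
    then show ?thesis using that by (fastforce simp: c_def filter_empty_conv)
  qed
  then have 2: "filter (\<lambda>x. x \<noteq> 0) (map c [Suc M..<Suc N]) = []"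
    by (auto simp: filter_empty_conv simp del: upt_Suc)
  have "conj_part xs = map c [1..<Suc M]"
    by (simp add: conj_part_def M_def c_def del: upt_Suc)
  then show ?thesis unfolding c_def[symmetric] split map_append filter_append 1 2 by simp
qed

lemma conj_part_filter: "conj_part (filter (\<lambda>x. x \<noteq> 0) xs) = conj_part xs"
proof -
  have "insert 0 (set (filter (\<lambda>x. x \<noteq> 0) xs)) = insert 0 (set xs)" by auto
  moreover have "filter (\<lambda>x. r \<le> x) (filter (\<lambda>x. x \<noteq> 0) xs) = filter (\<lambda>x. r \<le> x) xs"
    if "1 \<le> r" for r
    using that by (auto intro!: filter_cong)
  ultimately show ?thesis unfolding conj_part_def by (auto simp del: upt_Suc)
qed

text \<open>Entry i is at least r iff more than i entries are at least r, so the counts give back a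
  decreasing list. Trailing zeros leave no trace in the counts; the common length restores
  them.\<close>

lemma conj_part_inj:
  assumes "sorted_wrt (\<ge>) xs" "sorted_wrt (\<ge>) ys" "length xs = length ys" "conj_part xs = conj_part ys"
  shows "xs = ys"
proof (rule nth_equalityI[OF assms(3)])
  define c where "c zs r = length (filter (\<lambda>x. r \<le> x) zs)" for r :: nat and zs
  have nth: "c zs r = (if r \<le> length (conj_part zs) then conj_part zs ! (r - 1) else 0)" if "1 \<le> r" for zs r
  proof (cases "r \<le> Max (insert 0 (set zs))")
    case True
    have "[1..<Suc (Max (insert 0 (set zs)))] ! (r - 1) = 1 + (r - 1)"
      by (rule nth_upt) (use True that in linarith)
    then show ?thesis using that True by (simp add: conj_part_def c_def del: upt_Suc)
  next
    case False
    have "x \<le> Max (insert 0 (set zs))" if "x \<in> set zs" for x using that by simp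
    then have "\<forall>x \<in> set zs. \<not> r \<le> x" using False le_trans by blast
    then have "c zs r = 0" by (simp add: c_def filter_empty_conv)
    then show ?thesis using False by (simp add: conj_part_def)
  qed
  have iff: "r \<le> zs ! i \<longleftrightarrow> i < c zs r" if "sorted_wrt (\<ge>) zs" "i < length zs" for r i zs
    unfolding c_def using that by (intro sorted_nth_iff[where le = "(\<ge>)"]) auto
  fix i assume i: "i < length xs"
  have "r \<le> xs ! i \<longleftrightarrow> r \<le> ys ! i" for r
  proof (cases "r = 0")
    case False
    then have "c xs r = c ys r" using nth[of r] assms(4) by simp
    then show ?thesis using iff[OF assms(1) i] iff[OF assms(2), of i] i assms(3) by simp
  qed simp
  then show "xs ! i = ys ! i" by (meson le_antisym le_refl)
qed

definition row_sizes :: "nat \<Rightarrow> config \<Rightarrow> nat list" where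
  "row_sizes n b = map (\<lambda>i. card (dual b i)) [1..<Suc n]"

text \<open>Since every column is an initial segment, it contains r iff its height is at least r. So
  the r-th part of the conjugate partition is the size of row r, and only empty rows are
  dropped.\<close>

lemma shape_eq_row_sizes:
  assumes "b \<in> configs n l s" "tableau l b" "antitableau_dot n (dual b)"
  shows "shape l b = filter (\<lambda>x. x \<noteq> 0) (row_sizes n b)"
proof -
  note c = configsD[OF assms(1)]
  define xs where "xs = map (\<lambda>j. card (b j)) [1..<Suc l]"
  have "card (b j) \<le> n" for j
    using card_mono[OF finite_atLeastAtMost c(1)] by simp
  then have "conj_part xs =
      filter (\<lambda>x. x \<noteq> 0) (map (\<lambda>r. length (filter (\<lambda>x. r \<le> x) xs)) [1..<Suc n])"
    by (intro conj_part_eq_filter) (auto simp: xs_def simp del: upt_Suc)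
  also have "map (\<lambda>r. length (filter (\<lambda>x. r \<le> x) xs)) [1..<Suc n] = row_sizes n b"
    unfolding row_sizes_def
  proof (rule map_cong[OF refl])
    fix r assume "r \<in> set [1..<Suc n]"
    then have r: "1 \<le> r" by (simp del: upt_Suc)
    have mem: "r \<in> b j \<longleftrightarrow> r \<le> card (b j)" for j
      using source_columns[OF assms, of j] r by (metis atLeastAtMost_iff)
    have "length (filter (\<lambda>x. r \<le> x) xs) = length (filter (\<lambda>j. r \<le> card (b j)) [1..<Suc l])"
      by (simp add: xs_def filter_map o_def del: upt_Suc)
    also have "\<dots> = card (set (filter (\<lambda>j. r \<le> card (b j)) [1..<Suc l]))"
      by (rule distinct_card[symmetric]) simp
    also have "set (filter (\<lambda>j. r \<le> card (b j)) [1..<Suc l]) = dual b r"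
      using c(4)[of r] mem by (auto simp: less_Suc_eq_le simp del: upt_Suc)
    finally show "length (filter (\<lambda>x. r \<le> x) xs) = card (dual b r)" .
  qed
  finally show ?thesis unfolding shape_def xs_def .
qed

lemma shape_dot_dual: "shape_dot n (dual b) = conj_part (row_sizes n b)"
  by (simp add: shape_dot_def row_sizes_def)

lemma row_sizes_sorted:
  assumes "b \<in> configs n l s" "antitableau_dot n (dual b)"
  shows "sorted_wrt (\<ge>) (row_sizes n b)"
proof -
  have "sorted_wrt (\<lambda>i i'. card (dual b i') \<le> card (dual b i)) [1..<Suc n]"
    using assms(2) unfolding antitableau_pairs[OF assms(1)]
    by (rule sorted_wrt_mono_rel[rotated]) (auto dest: spec[of _ 0])
  then show ?thesis by (simp add: row_sizes_def sorted_wrt_map del: upt_Suc)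
qed

lemma shape_in_box:
  assumes "b \<in> configs n l s" "tableau l b" "antitableau_dot n (dual b)"
  shows "shape l b \<in> partitions_in_box n l s"
proof -
  have "sum_list (row_sizes n b) = s"
    using dual_configs[OF assms(1)]
    by (simp add: row_sizes_def configs_def interv_sum_list_conv_sum_set_nat atLeastLessThanSuc_atLeastAtMost del: upt_Suc)
  moreover have "sum_list (filter (\<lambda>x. x \<noteq> 0) xs) = sum_list xs" for xs :: "nat list"
    by (induction xs) auto
  moreover have "length (filter (\<lambda>x. x \<noteq> 0) (row_sizes n b)) \<le> n"
    using length_filter_le[of _ "row_sizes n b"] by (simp add: row_sizes_def del: upt_Suc)
  moreover have "x \<le> l" if "x \<in> set (row_sizes n b)" for x
    using that card_mono[OF finite_atLeastAtMost configsD(4)[OF assms(1)]]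
    by (auto simp: row_sizes_def simp del: upt_Suc)
  ultimately show ?thesis
    using sorted_wrt_filter[OF row_sizes_sorted[OF assms(1,3)]]
    unfolding shape_eq_row_sizes[OF assms] partitions_in_box_def by auto
qed


section \<open>The two crystal structures on configurations\<close>

lemma lower_opE:
  assumes "\<forall>p. finite (c p)" "lower_op ps k c = Some c'"
  obtains p where "first_plus (col_sign k c) ps = Some p" "p \<in> set ps" "col_sign k c p = 1" "c' = move_up k c p"
  using assms(2) first_plus_SomeD[of "col_sign k c" ps] unfolding lower_op_eq[OF assms(1)] by auto

lemma raise_opE:
  assumes "\<forall>p. finite (c p)" "raise_op ps k c = Some c'"
  obtains p where "last_minus (col_sign k c) ps = Some p" "p \<in> set ps" "col_sign k c p = -1" "c' = move_down k c p"
  using assms(2) last_minus_SomeD[of "col_sign k c" ps] unfolding raise_op_eq[OF assms(1)] by auto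

lemma card_move_up: "finite (c p) \<Longrightarrow> col_sign k c p = 1 \<Longrightarrow> card (move_up k c p y) = card (c y)"
  using card_Suc_Diff1[of "c p" k] by (simp add: move_up_def col_sign_eq_1)

lemma card_move_down: "finite (c p) \<Longrightarrow> col_sign k c p = -1 \<Longrightarrow> card (move_down k c p y) = card (c y)"
  using card_Suc_Diff1[of "c p" "Suc k"] by (simp add: move_down_def col_sign_eq_m1)

lemma lower_op_card:
  assumes "\<forall>p. finite (c p)" "lower_op ps k c = Some c'"
  shows "card (c' y) = card (c y)"
proof -
  obtain p where "col_sign k c p = 1" "c' = move_up k c p" using lower_opE[OF assms] .
  then show ?thesis using assms(1) by (simp add: card_move_up)
qed

lemma lower_op_configs:
  assumes "c \<in> configs m q s" "set ps = {1..q}" "1 \<le> k" "k < m" "lower_op ps k c = Some c'"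
  shows "c' \<in> configs m q s"
proof -
  obtain p where p: "p \<in> set ps" "col_sign k c p = 1" "c' = move_up k c p"
    using lower_opE[OF configs_finite[OF assms(1)] assms(5)] by metis
  have "card (c' y) = card (c y)" for y
    using p configsD(3)[OF assms(1)] by (simp add: card_move_up)
  moreover have "c' y \<subseteq> {1..m}" for y
    using configsD(1)[OF assms(1), of y] assms(3,4) p(3) by (auto simp: move_up_def)
  moreover have "c' y = {}" if "y \<notin> {1..q}" for y
    using configsD(2)[OF assms(1) that] p(1,3) assms(2) that by (auto simp: move_up_def)
  ultimately show ?thesis using assms(1) by (simp add: configs_def)
qed

lemma raise_op_configs:
  assumes "c \<in> configs m q s" "set ps = {1..q}" "1 \<le> k" "k < m" "raise_op ps k c = Some c'"
  shows "c' \<in> configs m q s"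
proof -
  obtain p where p: "p \<in> set ps" "col_sign k c p = -1" "c' = move_down k c p"
    using raise_opE[OF configs_finite[OF assms(1)] assms(5)] by metis
  have "card (c' y) = card (c y)" for y
    using p configsD(3)[OF assms(1)] by (simp add: card_move_down)
  moreover have "c' y \<subseteq> {1..m}" for y
    using configsD(1)[OF assms(1), of y] assms(3,4) p(3) by (auto simp: move_down_def)
  moreover have "c' y = {}" if "y \<notin> {1..q}" for y
    using configsD(2)[OF assms(1) that] p(1,3) assms(2) that by (auto simp: move_down_def)
  ultimately show ?thesis using assms(1) by (simp add: configs_def)
qed

text \<open>The measure for the climb to a source: lowering replaces one letter k by k + 1.\<close>

definition letter_sum :: "nat \<Rightarrow> config \<Rightarrow> nat" where
  "letter_sum q c = (\<Sum>p = 1..q. \<Sum>(c p))"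

lemma letter_sum_lower_op:
  assumes "\<forall>p. finite (c p)" "set ps = {1..q}" "lower_op ps k c = Some c'"
  shows "letter_sum q c < letter_sum q c'"
proof -
  obtain p where p: "p \<in> {1..q}" "col_sign k c p = 1" "c' = move_up k c p"
    using lower_opE[OF assms(1,3)] assms(2) by metis
  have fin: "finite (c p)" using assms(1) by simp
  have k: "k \<in> c p" "Suc k \<notin> c p" using p(2) by (simp_all add: col_sign_eq_1)
  have "\<Sum>(c' p) = Suc k + \<Sum>(c p - {k})"
    using fin k by (simp add: p(3) move_up_def)
  moreover have "\<Sum>(c p) = k + \<Sum>(c p - {k})"
    by (rule sum.remove[OF fin k(1)])
  ultimately have "\<Sum>(c p) < \<Sum>(c' p)" by simp
  moreover have "c' y = c y" if "y \<noteq> p" for y using that p(3) by (simp add: move_up_def)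
  ultimately have "\<forall>y \<in> {1..q}. \<Sum>(c y) \<le> \<Sum>(c' y)" by (metis le_refl less_imp_le)
  then show ?thesis unfolding letter_sum_def
    using p(1) \<open>\<Sum>(c p) < \<Sum>(c' p)\<close> by (intro sum_strict_mono_ex1) blast+
qed

lemma dual_op_eq_Some_iff: "dual_op \<phi> b = Some c \<longleftrightarrow> \<phi> (dual b) = Some (dual c)"
proof -
  have "dual d = c \<longleftrightarrow> d = dual c" for d by (metis dual_dual)
  then show ?thesis by (simp add: dual_op_def)
qed

lemma dual_op_eq_None_iff: "dual_op \<phi> b = None \<longleftrightarrow> \<phi> (dual b) = None"
  by (simp add: dual_op_def)

lemma apply_seq_dual_op:
  "apply_seq (\<lambda>j. dual_op (\<phi> j)) jj b = Some c \<longleftrightarrow> apply_seq \<phi> jj (dual b) = Some (dual c)"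
proof (induction jj arbitrary: b)
  case Nil
  show ?case by (metis apply_seq.simps(1) dual_dual option.inject)
next
  case (Cons j jj)
  show ?case
  proof (cases "\<phi> j (dual b)")
    case None
    then show ?thesis by (simp add: dual_op_def)
  next
    case (Some d)
    then show ?thesis using Cons.IH[of "dual d"] by (simp add: dual_op_def)
  qed
qed

lemma f_closed: "1 \<le> i \<Longrightarrow> i < n \<Longrightarrow> closed_under (configs n l s) (f_op l i)"
  unfolding closed_under_def f_op_def using lower_op_configs[of _ n l s "orderF l" i] by simp

lemma e_closed: "1 \<le> i \<Longrightarrow> i < n \<Longrightarrow> closed_under (configs n l s) (e_op l i)"
  unfolding closed_under_def e_op_def using raise_op_configs[of _ n l s "orderF l" i] by simp

lemma dual_closed:
  assumes "closed_under (configs l n s) \<phi>"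
  shows "closed_under (configs n l s) (dual_op \<phi>)"
  unfolding closed_under_def dual_op_eq_Some_iff
proof (intro ballI allI impI)
  fix b c assume "b \<in> configs n l s" "\<phi> (dual b) = Some (dual c)"
  then have "dual c \<in> configs l n s" using closed_underD[OF assms dual_configs] by blast
  then show "c \<in> configs n l s" using dual_configs[of "dual c"] by simp
qed

lemma fdot_closed: "1 \<le> j \<Longrightarrow> j < l \<Longrightarrow> closed_under (configs n l s) (dual_op (fdot_op n j))"
  by (rule dual_closed)
    (use lower_op_configs[of _ l n s "orderFdot n" j] in \<open>simp add: closed_under_def fdot_op_def\<close>)

lemma edot_closed: "1 \<le> j \<Longrightarrow> j < l \<Longrightarrow> closed_under (configs n l s) (dual_op (edot_op n j))"
  by (rule dual_closed)
    (use raise_op_configs[of _ l n s "orderFdot n" j] in \<open>simp add: closed_under_def edot_op_def\<close>)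

lemma f_e_inverse: "inverse_ops (configs n l s) (f_op l i) (e_op l i)"
  unfolding inverse_ops_def f_op_def e_op_def
  by (intro ballI lower_raise_iff distinct_orders configs_finite)

lemma fdot_edot_inverse: "inverse_ops (configs n l s) (dual_op (fdot_op n j)) (dual_op (edot_op n j))"
  unfolding inverse_ops_def fdot_op_def edot_op_def dual_op_eq_Some_iff
  by (intro ballI lower_raise_iff distinct_orders) (rule configs_finite, erule dual_configs)+

section \<open>Commutation of the four pairs of operators on configurations\<close>

context
  fixes n l s i j :: nat
  assumes i: "1 \<le> i" "i < n" and j: "1 \<le> j" "j < l"
begin

lemma f_opE:
  assumes "b \<in> configs n l s" "f_op l i b = Some c"
  obtains q where "first_plus (col_sign i b) (orderF l) = Some q" "c = move_up i b q"
  by (rule lower_opE[OF configs_finite[OF assms(1)] assms(2)[unfolded f_op_def]]) (rule that)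

lemma fdot_opE:
  assumes "b \<in> configs n l s" "dual_op (fdot_op n j) b = Some c"
  obtains r where "first_plus (col_sign j (dual b)) (orderFdot n) = Some r" "c = dual (move_up j (dual b) r)"
proof (rule lower_opE[OF configs_finite[OF dual_configs[OF assms(1)]]
      assms(2)[unfolded fdot_op_def dual_op_eq_Some_iff]])
  fix r assume "first_plus (col_sign j (dual b)) (orderFdot n) = Some r" "dual c = move_up j (dual b) r"
  then show thesis using that by (metis dual_dual)
qed

lemma f_op_None_iff: "b \<in> configs n l s \<Longrightarrow> f_op l i b = None \<longleftrightarrow> first_plus (col_sign i b) (orderF l) = None"
  unfolding f_op_def by (rule lower_op_None_iff[OF configs_finite])

lemma fdot_op_None_iff:
  "b \<in> configs n l s \<Longrightarrow> dual_op (fdot_op n j) b = None \<longleftrightarrow> first_plus (col_sign j (dual b)) (orderFdot n) = None"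
  unfolding fdot_op_def dual_op_eq_None_iff
  by (rule lower_op_None_iff[OF configs_finite[OF dual_configs]])

lemma e_op_None_iff: "b \<in> configs n l s \<Longrightarrow> e_op l i b = None \<longleftrightarrow> minus_count (col_sign i b) (orderF l) = 0"
  unfolding e_op_def by (rule raise_op_None_iff[OF configs_finite])

lemma edot_op_None_iff:
  "b \<in> configs n l s \<Longrightarrow> dual_op (edot_op n j) b = None \<longleftrightarrow> minus_count (col_sign j (dual b)) (orderFdot n) = 0"
  unfolding edot_op_def dual_op_eq_None_iff
  by (rule raise_op_None_iff[OF configs_finite[OF dual_configs]])

lemma None_after_fdot:
  assumes "b \<in> configs n l s" "dual_op (fdot_op n j) b = Some c"
  shows "f_op l i c = None \<longleftrightarrow> f_op l i b = None" "e_op l i c = None \<longleftrightarrow> e_op l i b = None"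
proof -
  obtain r where r: "first_plus (col_sign j (dual b)) (orderFdot n) = Some r" "c = dual (move_up j (dual b) r)"
    using fdot_opE[OF assms] .
  note cX = closed_underD[OF fdot_closed[OF j] assms]
  show "f_op l i c = None \<longleftrightarrow> f_op l i b = None" "e_op l i c = None \<longleftrightarrow> e_op l i b = None"
    using row_signs_after_column_move[OF i j r(1)]
    by (simp_all add: f_op_None_iff e_op_None_iff assms(1) cX r(2)[symmetric])
qed

lemma None_after_f:
  assumes "b \<in> configs n l s" "f_op l i b = Some c"
  shows "dual_op (fdot_op n j) c = None \<longleftrightarrow> dual_op (fdot_op n j) b = None"
    "dual_op (edot_op n j) c = None \<longleftrightarrow> dual_op (edot_op n j) b = None"
proof -
  obtain q where q: "first_plus (col_sign i b) (orderF l) = Some q" "c = move_up i b q"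
    using f_opE[OF assms] .
  note cX = closed_underD[OF f_closed[OF i] assms]
  show "dual_op (fdot_op n j) c = None \<longleftrightarrow> dual_op (fdot_op n j) b = None"
    "dual_op (edot_op n j) c = None \<longleftrightarrow> dual_op (edot_op n j) b = None"
    using column_signs_after_row_move[OF i j q(1)]
    by (simp_all add: fdot_op_None_iff edot_op_None_iff assms(1) cX q(2)[symmetric])
qed

lemma f_fdot_commuting: "commuting (configs n l s) (f_op l i) (dual_op (fdot_op n j))"
  unfolding commuting_def
proof (intro ballI conjI allI impI)
  fix b c d assume b: "b \<in> configs n l s" and c: "f_op l i b = Some c"
    and d: "dual_op (fdot_op n j) b = Some d"
  obtain q where q: "first_plus (col_sign i b) (orderF l) = Some q" "c = move_up i b q"
    using f_opE[OF b c] .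
  obtain r where r: "first_plus (col_sign j (dual b)) (orderFdot n) = Some r" "d = dual (move_up j (dual b) r)"
    using fdot_opE[OF b d] .
  have cX: "c \<in> configs n l s" and dX: "d \<in> configs n l s"
    using closed_underD[OF f_closed[OF i] b c] closed_underD[OF fdot_closed[OF j] b d] .
  obtain q' r' where qr: "first_plus (col_sign i d) (orderF l) = Some q'" "first_plus (col_sign j (dual c)) (orderFdot n) = Some r'"
    "move_up i d q' = dual (move_up j (dual c) r')"
    using moves_commute[OF i j q(1) r(1)] q(2) r(2) by blast
  have "f_op l i d = Some (move_up i d q')"
    using qr(1) by (simp add: f_op_def lower_op_eq[OF configs_finite[OF dX]])
  moreover have "dual_op (fdot_op n j) c = Some (move_up i d q')"
    using qr(2,3) by (simp add: dual_op_def fdot_op_def lower_op_eq[OF configs_finite[OF dual_configs[OF cX]]])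
  ultimately show "\<exists>z. f_op l i d = Some z \<and> dual_op (fdot_op n j) c = Some z" by blast
next
  fix b c assume "b \<in> configs n l s" "f_op l i b = Some c" "dual_op (fdot_op n j) b = None"
  then show "dual_op (fdot_op n j) c = None" using None_after_f(1) by simp
next
  fix b d assume "b \<in> configs n l s" "dual_op (fdot_op n j) b = Some d" "f_op l i b = None"
  then show "f_op l i d = None" using None_after_fdot(1) by simp
qed

lemma e_fdot_commuting: "commuting (configs n l s) (e_op l i) (dual_op (fdot_op n j))"
  by (rule commuting_inverse[OF f_fdot_commuting f_e_inverse e_closed[OF i] fdot_closed[OF j]])
    (rule None_after_fdot(2))

lemma f_edot_commuting: "commuting (configs n l s) (f_op l i) (dual_op (edot_op n j))"
  by (rule commuting_sym, rule commuting_inverse[OF commuting_sym[OF f_fdot_commuting]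
      fdot_edot_inverse edot_closed[OF j] f_closed[OF i]])
    (rule None_after_f(2))

lemma e_edot_commuting: "commuting (configs n l s) (e_op l i) (dual_op (edot_op n j))"
proof (rule commuting_inverse[OF f_edot_commuting f_e_inverse e_closed[OF i] edot_closed[OF j]])
  fix b c assume b: "b \<in> configs n l s" and c: "dual_op (edot_op n j) b = Some c"
  have cX: "c \<in> configs n l s" using closed_underD[OF edot_closed[OF j] b c] .
  \<comment> \<open>Preservation of definedness is known along lowering dual operators, so the
    raising arrow from b to c is turned around.\<close>
  have "dual_op (fdot_op n j) c = Some b"
    using inverse_opsD[OF fdot_edot_inverse cX b] c by simp
  then show "e_op l i c = None \<longleftrightarrow> e_op l i b = None"
    using None_after_fdot(2)[OF cX] by simp
qed

end

definition col_sizes :: "config \<Rightarrow> nat \<Rightarrow> nat" where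
  "col_sizes b j = card (b j)"

lemma e_source_iff:
  "b \<in> configs n l s \<Longrightarrow> (\<forall>i \<in> {1..<n}. e_op l i b = None) \<longleftrightarrow> antitableau_dot n (dual b)"
  by (simp add: antitableau_iff e_op_def)

lemma h_source_iff:
  "b \<in> configs n l s \<Longrightarrow> (\<forall>j \<in> {1..<l}. dual_op (edot_op n j) b = None) \<longleftrightarrow> tableau l b"
  by (simp add: tableau_iff edot_op_def dual_op_eq_None_iff)

text \<open>Row sizes are the column sizes of the dual, so both invariants rest on one fact: an
  operator moves an entry inside its column. Sources are determined by either invariant because
  their columns and their rows are initial segments.\<close>

lemma bicrystal_configs:
  "bicrystal (configs n l s) {1..<n} {1..<l} (f_op l) (e_op l)
    (\<lambda>j. dual_op (fdot_op n j)) (\<lambda>j. dual_op (edot_op n j))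
    col_sizes (\<lambda>b. col_sizes (dual b)) (letter_sum l) (\<lambda>b. letter_sum n (dual b))"
proof
  fix b c i assume i: "i \<in> {1..<n}" and b: "b \<in> configs n l s" and c: "f_op l i b = Some c"
  show "col_sizes c = col_sizes b"
    using lower_op_card[OF configs_finite[OF b] c[unfolded f_op_def]] by (simp add: col_sizes_def fun_eq_iff)
  show "letter_sum l b < letter_sum l c"
    by (rule letter_sum_lower_op[OF configs_finite[OF b] set_orders(1) c[unfolded f_op_def]])
next
  fix b c j assume j: "j \<in> {1..<l}" and b: "b \<in> configs n l s" and c: "dual_op (fdot_op n j) b = Some c"
  note c' = c[unfolded dual_op_eq_Some_iff fdot_op_def]
  show "col_sizes (dual c) = col_sizes (dual b)"
    using lower_op_card[OF configs_finite[OF dual_configs[OF b]] c'] by (simp add: col_sizes_def fun_eq_iff)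
  show "letter_sum n (dual b) < letter_sum n (dual c)"
    by (rule letter_sum_lower_op[OF configs_finite[OF dual_configs[OF b]] set_orders(2) c'])
next
  fix u v assume uv: "u \<in> configs n l s" "v \<in> configs n l s"
    and e: "\<forall>i \<in> {1..<n}. e_op l i u = None \<and> e_op l i v = None"
    and h: "\<forall>j \<in> {1..<l}. dual_op (edot_op n j) u = None \<and> dual_op (edot_op n j) v = None"
  have a: "antitableau_dot n (dual u)" "antitableau_dot n (dual v)"
    using e e_source_iff[OF uv(1)] e_source_iff[OF uv(2)] by simp_all
  have t: "tableau l u" "tableau l v"
    using h h_source_iff[OF uv(1)] h_source_iff[OF uv(2)] by simp_all
  {
    assume "col_sizes u = col_sizes v"
    then have "card (u j) = card (v j)" for j by (simp add: col_sizes_def fun_eq_iff)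
    then have "u j = v j" for j
      using source_columns[OF uv(1) t(1) a(1)] source_columns[OF uv(2) t(2) a(2)] by metis
    then show "u = v" by blast
  next
    assume "col_sizes (dual u) = col_sizes (dual v)"
    then have "card (dual u j) = card (dual v j)" for j by (simp add: col_sizes_def fun_eq_iff)
    then have "dual u j = dual v j" for j
      using source_rows[OF uv(1) t(1) a(1)] source_rows[OF uv(2) t(2) a(2)] by metis
    then have "dual u = dual v" by blast
    then show "u = v" by (metis dual_dual)
  }
qed (simp_all add: f_closed e_closed fdot_closed edot_closed f_e_inverse fdot_edot_inverse
    f_fdot_commuting e_fdot_commuting f_edot_commuting e_edot_commuting)


section \<open>The correspondence\<close>

lemma word_wt_reading:
  assumes "\<forall>p. finite (c p)" "distinct ps"
  shows "word_wt (reading_word ps c) k =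
    int (card (dual c k \<inter> set ps)) - int (card (dual c (Suc k) \<inter> set ps))"
proof -
  have column: "sum_list (map (letter_sign k) (sorted_list_of_set (c p))) = col_sign k c p" for p
  proof -
    have "sum_list (map (letter_sign k) (sorted_list_of_set (c p))) = (\<Sum>x \<in> c p. letter_sign k x)"
      using assms(1) by (simp add: sum_list_distinct_conv_sum_set)
    also have "\<dots> = col_sign k c p"
      using assms(1) by (simp add: letter_sign_def col_sign_def sum_subtractf of_bool_def)
    finally show ?thesis .
  qed
  have "word_wt (reading_word ps c) k = sum_list (map (letter_sign k) (reading_word ps c))"
    by (simp add: word_wt_def sum_list_letter_sign)
  also have "\<dots> = sum_list (map (col_sign k c) ps)"
    by (induction ps) (simp_all add: reading_word_def reading_Cons reading_def o_def column[symmetric])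
  finally show ?thesis using sum_list_col_sign[OF assms(2)] by simp
qed

text \<open>The weight for one family depends only on the sizes preserved by the other. Hence P has
  the row weights of b, and Q its column weights.\<close>

lemma word_wt_configs:
  assumes "c \<in> configs m q s" "distinct ps" "set ps = {1..q}"
  shows "word_wt (reading_word ps c) k = int (card (dual c k)) - int (card (dual c (Suc k)))"
proof -
  have "dual c k \<inter> {1..q} = dual c k" for k using configsD(4)[OF assms(1)] by (rule Int_absorb2)
  then show ?thesis unfolding word_wt_reading[OF configs_finite[OF assms(1)] assms(2)] assms(3) by simp
qed

context
  fixes n l s :: nat
begin

interpretation F: bicrystal "configs n l s" "{1..<n}" "{1..<l}" "f_op l" "e_op l"
  "\<lambda>j. dual_op (fdot_op n j)" "\<lambda>j. dual_op (edot_op n j)"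
  col_sizes "\<lambda>b. col_sizes (dual b)" "letter_sum l" "\<lambda>b. letter_sum n (dual b)"
  by (rule bicrystal_configs)

lemma is_source_iff:
  "F.is_source u \<longleftrightarrow> u \<in> configs n l s \<and> tableau l u \<and> antitableau_dot n (dual u)"
  unfolding F.is_source_def using e_source_iff h_source_iff by blast

lemma source_yamanouchi_iff:
  "F.is_source u \<longleftrightarrow> u \<in> configs n l s \<and> tableau l u \<and> yamanouchi (reading_word (orderF l) u)"
  unfolding is_source_iff using antitableau_iff yamanouchi_iff by blast

lemma factorization_iff: "factorization n l s b u ii jj \<longleftrightarrow> (\<exists>p q. F.factors b u p q ii jj)"
proof -
  have I: "{1..n - 1} = {1..<n}" "{1..l - 1} = {1..<l}" by auto
  show ?thesis
  proof
    assume a: "factorization n l s b u ii jj"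
    then have u: "F.is_source u" "set ii \<subseteq> {1..<n}" "set jj \<subseteq> {1..<l}"
      unfolding factorization_def source_yamanouchi_iff Fset_def I by auto
    obtain p where "apply_seq (f_op l) ii u = Some p"
      "apply_seq (\<lambda>j. dual_op (fdot_op n j)) jj p = Some b"
      using a unfolding factorization_def bind_eq_Some_conv by blast
    then show "\<exists>p q. F.factors b u p q ii jj" using F.factorsI[OF u] by blast
  next
    assume "\<exists>p q. F.factors b u p q ii jj"
    then show "factorization n l s b u ii jj"
      unfolding factorization_def F.factors_def source_yamanouchi_iff Fset_def I by auto
  qed
qed

text \<open>Every factorization of b extends to a square, and all squares over b share their
  corners; this resolves the three descriptions \<open>source\<close>, \<open>P_symbol\<close> and
  \<open>Q_symbol\<close> at once.\<close>

lemma symbols_eq: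
  assumes "F.factors b u p q ii jj"
  shows "source n l s b = u" "P_symbol n l s b = p" "Q_symbol n l s b = dual q"
proof -
  have uniq: "u' = u \<and> apply_seq (f_op l) ii' u' = Some p \<and>
      apply_seq (fdot_op n) jj' (dual u') = Some (dual q)"
    if fac: "factorization n l s b u' ii' jj'" for u' ii' jj'
  proof -
    obtain p' q' where *: "F.factors b u' p' q' ii' jj'" using fac unfolding factorization_iff by blast
    then have "u' = u" "p' = p" "q' = q" using F.factors_unique[OF assms *] by simp_all
    then show ?thesis using * unfolding F.factors_def apply_seq_dual_op by simp
  qed
  have ex: "factorization n l s b u ii jj" unfolding factorization_iff using assms by blast
  show s: "source n l s b = u" unfolding source_def
  proof (rule the_equality)
    show "\<exists>ii jj. factorization n l s b u ii jj" using ex by blast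
    fix u' assume "\<exists>ii jj. factorization n l s b u' ii jj"
    then obtain ii' jj' where "factorization n l s b u' ii' jj'" by blast
    from uniq[OF this] show "u' = u" by simp
  qed
  show "P_symbol n l s b = p" unfolding P_symbol_def s
  proof (rule the_equality)
    show "\<exists>ii jj. factorization n l s b u ii jj \<and> apply_seq (f_op l) ii u = Some p"
      using ex uniq[OF ex] by blast
    fix p' assume "\<exists>ii jj. factorization n l s b u ii jj \<and> apply_seq (f_op l) ii u = Some p'"
    then obtain ii' jj' where w: "factorization n l s b u ii' jj'" "apply_seq (f_op l) ii' u = Some p'" by blast
    show "p' = p" using uniq[OF w(1)] w(2) by simp
  qed
  show "Q_symbol n l s b = dual q" unfolding Q_symbol_def s
  proof (rule the_equality)
    show "\<exists>ii jj. factorization n l s b u ii jj \<and> apply_seq (fdot_op n) jj (dual u) = Some (dual q)"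
      using ex uniq[OF ex] by blast
    fix q' assume "\<exists>ii jj. factorization n l s b u ii jj \<and> apply_seq (fdot_op n) jj (dual u) = Some q'"
    then obtain ii' jj' where w: "factorization n l s b u ii' jj'" "apply_seq (fdot_op n) jj' (dual u) = Some q'" by blast
    show "q' = dual q" using uniq[OF w(1)] w(2) by simp
  qed
qed

text \<open>The corner p inherits the column sizes of u, and q its row sizes. For the source u, the
  nonzero row sizes are the parts of its shape, so the two shapes are conjugate.\<close>

lemma factors_shapes:
  assumes "F.factors b u p q ii jj"
  shows "tableau l p" "antitableau_dot n (dual q)" "shape l p = shape l u"
    "shape l u \<in> partitions_in_box n l s" "shape_dot n (dual q) = conj_part (shape l u)"
proof -
  note X = F.factorsD[OF assms]
  have u: "u \<in> configs n l s" "tableau l u" "antitableau_dot n (dual u)"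
    using assms unfolding F.factors_def is_source_iff by simp_all
  show "tableau l p" using h_source_iff[OF X(2)] X(7) by simp
  show "antitableau_dot n (dual q)" using e_source_iff[OF X(3)] X(8) by simp
  have "card (p j) = card (u j)" for j using X(5) by (simp add: col_sizes_def fun_eq_iff)
  then show "shape l p = shape l u" by (simp add: shape_def)
  show "shape l u \<in> partitions_in_box n l s" by (rule shape_in_box[OF u])
  have "card (dual q i) = card (dual u i)" for i using X(6) by (simp add: col_sizes_def fun_eq_iff)
  then have "row_sizes n q = row_sizes n u" by (simp add: row_sizes_def)
  then show "shape_dot n (dual q) = conj_part (shape l u)"
    unfolding shape_dot_dual shape_eq_row_sizes[OF u] conj_part_filter by simp
qed

text \<open>Surjectivity onto pairs of conjugate shapes: p and the dual of d are climbed to sources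
  u and v. Conjugate shapes force equal row sizes and thus u = v; b is the corner opposite to this
  common source.\<close>

lemma factors_of_pair:
  assumes "p \<in> configs n l s" "tableau l p" "d \<in> configs l n s" "antitableau_dot n d"
    and "shape_dot n d = conj_part (shape l p)"
  shows "\<exists>b u ii jj. F.factors b u p (dual d) ii jj"
proof -
  define q where "q = dual d"
  have q: "q \<in> configs n l s" "dual q = d" using dual_configs[OF assms(3)] by (simp_all add: q_def)
  obtain ii u where u: "set ii \<subseteq> {1..<n}" "F.is_source u" "apply_seq (f_op l) ii u = Some p"
      "col_sizes u = col_sizes p"
    using F.h_source_reach[OF assms(1)] h_source_iff[OF assms(1)] assms(2) by auto
  obtain jj v where v: "set jj \<subseteq> {1..<l}" "F.is_source v"
      "apply_seq (\<lambda>j. dual_op (fdot_op n j)) jj v = Some q" "col_sizes (dual v) = col_sizes (dual q)"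
    using F.e_source_reach[OF q(1)] e_source_iff[OF q(1)] assms(4) q(2) by auto
  note us = u(2)[unfolded is_source_iff] and vs = v(2)[unfolded is_source_iff]
  have "card (u j) = card (p j)" for j using u(4) by (simp add: col_sizes_def fun_eq_iff)
  then have "shape l p = shape l u" by (simp add: shape_def)
  then have 1: "conj_part (shape l p) = conj_part (row_sizes n u)"
    using shape_eq_row_sizes us conj_part_filter by metis
  have "card (dual v i) = card (dual q i)" for i using v(4) by (simp add: col_sizes_def fun_eq_iff)
  then have "row_sizes n v = row_sizes n q" by (simp add: row_sizes_def)
  then have 2: "shape_dot n d = conj_part (row_sizes n v)"
    using shape_dot_dual[of n q] q(2) by simp
  \<comment> \<open>Equality of the conjugates leaves open only the number of empty rows, and both
    lists have length n.\<close>
  have "row_sizes n u = row_sizes n v"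
  proof (rule conj_part_inj)
    show "sorted_wrt (\<ge>) (row_sizes n u)" "sorted_wrt (\<ge>) (row_sizes n v)"
      using us vs row_sizes_sorted by blast+
    show "length (row_sizes n u) = length (row_sizes n v)" by (simp add: row_sizes_def)
    show "conj_part (row_sizes n u) = conj_part (row_sizes n v)" using 1 2 assms(5) by simp
  qed
  then have "\<forall>i \<in> set [1..<Suc n]. card (dual u i) = card (dual v i)"
    unfolding row_sizes_def map_eq_conv .
  then have "card (dual u i) = card (dual v i)" for i
    using configsD(5)[of u n l s i] configsD(5)[of v n l s i] us vs
    by (cases "i \<in> {1..n}") (simp_all del: upt_Suc add: less_Suc_eq_le)
  then have "col_sizes (dual u) = col_sizes (dual v)" by (simp add: col_sizes_def fun_eq_iff)
  then have "u = v" using F.source_eqI[OF u(2) v(2)] by simp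
  have uX: "u \<in> configs n l s" using us by simp
  obtain b where "apply_seq (\<lambda>j. dual_op (fdot_op n j)) jj p = Some b"
    using commuting_both[OF F.seq_comm(1)[OF u(1) v(1)] uX u(3)] v(3) \<open>u = v\<close> by blast
  from F.factorsI[OF u(2,1) v(1) u(3) this] obtain q' where q': "F.factors b u p q' ii jj" by blast
  then have "q' = q" using v(3) \<open>u = v\<close> unfolding F.factors_def by simp
  with q' show ?thesis unfolding q_def by blast
qed

lemma Phi_inj: "inj_on (Phi n l s) (configs n l s)"
proof (rule inj_onI)
  fix b b' assume "b \<in> configs n l s" "b' \<in> configs n l s" and eq: "Phi n l s b = Phi n l s b'"
  then obtain u p q ii jj u' p' q' ii' jj'
    where 1: "F.factors b u p q ii jj" and 2: "F.factors b' u' p' q' ii' jj'"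
    using F.factors_exists by meson
  have "p' = p" "dual q' = dual q"
    using eq by (simp_all add: Phi_def symbols_eq[OF 1] symbols_eq[OF 2])
  then have "p' = p" "q' = q" by (metis dual_dual)+
  with 2 show "b = b'" using F.factors_inj[OF 1] by simp
qed

text \<open>The index of the summand is the shape of the source u, which is the same in the squares
  over b and over its image under any operator. One family changes only p and the other only q, as
  in the tensor product.\<close>

lemma F_crystal_iso:
  "crystal_iso (indices n l) (F_crystal n l s)
     (direct_sum_crystal (partitions_in_box n l s)
        (\<lambda>la. tensor_crystal (B_crystal n l s la) (Bdot_crystal n l s (conj_part la))))
     (\<lambda>b. (shape l (P_symbol n l s b), Phi n l s b))"
  (is "crystal_iso _ _ ?D ?\<psi>")
proof -
  have psi: "?\<psi> b = (shape l u, p, dual q)" if "F.factors b u p q ii jj" for b u p q ii jj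
    using symbols_eq[OF that] factors_shapes(3)[OF that] by (simp add: Phi_def)
  have elts: "elts ?D = (SIGMA la : partitions_in_box n l s.
      {c \<in> configs n l s. tableau l c \<and> shape l c = la} \<times>
      {d \<in> configs l n s. antitableau_dot n d \<and> shape_dot n d = conj_part la})"
    by (simp add: direct_sum_crystal_def tensor_crystal_def B_crystal_def Bdot_crystal_def
        Fset_def Fdot_def)
  have bij: "bij_betw ?\<psi> (configs n l s) (elts ?D)"
    unfolding bij_betw_def
  proof
    show "inj_on ?\<psi> (configs n l s)"
      using Phi_inj by (simp add: inj_on_def)
    show "?\<psi> ` configs n l s = elts ?D"
    proof (intro equalityI subsetI)
      fix x assume "x \<in> ?\<psi> ` configs n l s"
      then obtain b where b: "b \<in> configs n l s" "x = ?\<psi> b" by blast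
      obtain u p q ii jj where f: "F.factors b u p q ii jj" using F.factors_exists[OF b(1)] by blast
      show "x \<in> elts ?D"
        unfolding b(2) psi[OF f] elts
        using factors_shapes[OF f] F.factorsD(2,3)[OF f] dual_configs by simp
    next
      fix x assume "x \<in> elts ?D"
      then obtain la p d where x: "x = (la, p, d)" "p \<in> configs n l s" "tableau l p" "shape l p = la"
        "d \<in> configs l n s" "antitableau_dot n d" "shape_dot n d = conj_part la"
        unfolding elts by auto
      then obtain b u ii jj where f: "F.factors b u p (dual d) ii jj"
        using factors_of_pair by metis
      have "?\<psi> b = x"
        using psi[OF f] factors_shapes(3)[OF f] x by simp
      then show "x \<in> ?\<psi> ` configs n l s" using F.factorsD(4)[OF f] by blast
    qed
  qed
  have row: "eop ?D (Inl i) (?\<psi> b) = map_option ?\<psi> (e_op l i b) \<and>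
      fop ?D (Inl i) (?\<psi> b) = map_option ?\<psi> (f_op l i b) \<and>
      wt ?D (?\<psi> b) (Inl i) = word_wt (reading_word (orderF l) b) i"
    if b: "b \<in> configs n l s" and i: "i \<in> {1..<n}" for b i
  proof -
    obtain u p q ii jj where f: "F.factors b u p q ii jj" using F.factors_exists[OF b] by blast
    have step: "map_option (\<lambda>p'. (shape l u, p', dual q)) (x p) = map_option ?\<psi> (x b)"
      if op: "x = f_op l i \<or> x = e_op l i" for x
    proof (cases "x b")
      case None
      then show ?thesis using F.factors_f_step[OF f i op] by simp
    next
      case (Some b')
      then obtain p' ii' where p': "x p = Some p'" "F.factors b' u p' q ii' jj"
        using F.factors_f_step[OF f i op] by blast
      show ?thesis using p'(1) psi[OF p'(2)] by (simp add: Some)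
    qed
    have "set jj \<subseteq> {1..<l}" "apply_seq (\<lambda>j. dual_op (fdot_op n j)) jj p = Some b"
      using f unfolding F.factors_def by simp_all
    from F.seq_rs[OF this(1) F.factorsD(2)[OF f] this(2)]
    have "card (dual b k) = card (dual p k)" for k by (simp add: col_sizes_def fun_eq_iff)
    then have "word_wt (reading_word (orderF l) p) i = word_wt (reading_word (orderF l) b) i"
      by (simp add: word_wt_configs[OF F.factorsD(2)[OF f]] word_wt_configs[OF b])
    then show ?thesis
      using step[of "e_op l i"] step[of "f_op l i"] unfolding psi[OF f]
      by (simp add: direct_sum_crystal_def tensor_crystal_def B_crystal_def option.map_comp o_def)
  qed
  have col: "eop ?D (Inr j) (?\<psi> b) = map_option ?\<psi> (dual_op (edot_op n j) b) \<and>
      fop ?D (Inr j) (?\<psi> b) = map_option ?\<psi> (dual_op (fdot_op n j) b) \<and>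
      wt ?D (?\<psi> b) (Inr j) = word_wt (reading_word (orderFdot n) (dual b)) j"
    if b: "b \<in> configs n l s" and j: "j \<in> {1..<l}" for b j
  proof -
    obtain u p q ii jj where f: "F.factors b u p q ii jj" using F.factors_exists[OF b] by blast
    have step: "map_option (\<lambda>d'. (shape l u, p, d')) (x (dual q)) = map_option ?\<psi> (dual_op x b)"
      if "x = fdot_op n j \<or> x = edot_op n j" for x
    proof -
      have op: "dual_op x = dual_op (fdot_op n j) \<or> dual_op x = dual_op (edot_op n j)"
        using that by blast
      show ?thesis
      proof (cases "dual_op x b")
        case None
        then show ?thesis using F.factors_g_step[OF f j op] by (simp add: dual_op_eq_None_iff)
      next
        case (Some b')
        then obtain q' jj' where q': "dual_op x q = Some q'" "F.factors b' u p q' ii jj'"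
          using F.factors_g_step[OF f j op] by blast
        show ?thesis
          using q'(1)[unfolded dual_op_eq_Some_iff] psi[OF q'(2)] by (simp add: Some)
      qed
    qed
    have "set ii \<subseteq> {1..<n}" "apply_seq (f_op l) ii q = Some b"
      using f unfolding F.factors_def by simp_all
    from F.seq_cs[OF this(1) F.factorsD(3)[OF f] this(2)]
    have "card (b k) = card (q k)" for k by (simp add: col_sizes_def fun_eq_iff)
    then have "word_wt (reading_word (orderFdot n) (dual q)) j = word_wt (reading_word (orderFdot n) (dual b)) j"
      by (simp add: word_wt_configs[OF dual_configs[OF F.factorsD(3)[OF f]]] word_wt_configs[OF dual_configs[OF b]])
    then show ?thesis
      using step[of "edot_op n j"] step[of "fdot_op n j"] unfolding psi[OF f]
      by (simp add: direct_sum_crystal_def tensor_crystal_def Bdot_crystal_def option.map_comp o_def)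
  qed
  show ?thesis
    unfolding crystal_iso_def
    using bij row col by (auto simp: F_crystal_def Fset_def indices_def)
qed

lemma correspondence:
  assumes "b \<in> configs n l s"
  shows "(\<exists>!u. \<exists>ii jj. factorization n l s b u ii jj) \<and>
    (\<forall>ii jj. factorization n l s b (source n l s b) ii jj \<longrightarrow>
       apply_seq (f_op l) ii (source n l s b) = Some (P_symbol n l s b) \<and>
       apply_seq (fdot_op n) jj (dual (source n l s b)) = Some (Q_symbol n l s b)) \<and>
    P_symbol n l s b \<in> configs n l s \<and> tableau l (P_symbol n l s b) \<and>
    Q_symbol n l s b \<in> configs l n s \<and> antitableau_dot n (Q_symbol n l s b) \<and>
    shape_dot n (Q_symbol n l s b) = conj_part (shape l (P_symbol n l s b))"
proof -
  obtain u p q ii jj where f: "F.factors b u p q ii jj" using F.factors_exists[OF assms] by blast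
  have uniq: "u' = u \<and> p' = p \<and> q' = q" if "F.factors b u' p' q' ii' jj'" for u' p' q' ii' jj'
    by (rule F.factors_unique[OF f that])
  have "\<exists>!u. \<exists>ii jj. factorization n l s b u ii jj"
    unfolding factorization_iff using f uniq by blast
  moreover have "apply_seq (f_op l) ii' u = Some p \<and> apply_seq (fdot_op n) jj' (dual u) = Some (dual q)"
    if fac: "factorization n l s b u ii' jj'" for ii' jj'
  proof -
    obtain p' q' where f': "F.factors b u p' q' ii' jj'" using fac unfolding factorization_iff by blast
    then show ?thesis using uniq[OF f'] unfolding F.factors_def apply_seq_dual_op by simp
  qed
  ultimately show ?thesis
    unfolding symbols_eq[OF f]
    using factors_shapes[OF f] F.factorsD(2,3)[OF f] dual_configs by simp
qed

end

theorem theorem2p25: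
  fixes n l s :: nat
  assumes "2 \<le> n" and "2 \<le> l"
  shows "(\<forall>b \<in> Fset n l s.
            (\<exists>!u. \<exists>ii jj. factorization n l s b u ii jj) \<and>
            (\<forall>ii jj. factorization n l s b (source n l s b) ii jj \<longrightarrow>
               apply_seq (f_op l) ii (source n l s b) = Some (P_symbol n l s b) \<and>
               apply_seq (fdot_op n) jj (dual (source n l s b)) = Some (Q_symbol n l s b)) \<and>
            P_symbol n l s b \<in> Fset n l s \<and> tableau l (P_symbol n l s b) \<and>
            Q_symbol n l s b \<in> Fdot n l s \<and> antitableau_dot n (Q_symbol n l s b) \<and>
            shape_dot n (Q_symbol n l s b) = conj_part (shape l (P_symbol n l s b))) \<and>
         bij_betw (Phi n l s) (Fset n l s) (Phi n l s ` Fset n l s) \<and>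
         crystals_isomorphic (indices n l) (F_crystal n l s)
           (direct_sum_crystal (partitions_in_box n l s)
              (\<lambda>la. tensor_crystal (B_crystal n l s la) (Bdot_crystal n l s (conj_part la))))"
proof (rule conjI[OF ballI conjI])
  show "bij_betw (Phi n l s) (Fset n l s) (Phi n l s ` Fset n l s)"
    unfolding Fset_def by (rule inj_on_imp_bij_betw[OF Phi_inj])
  show "crystals_isomorphic (indices n l) (F_crystal n l s)
      (direct_sum_crystal (partitions_in_box n l s)
        (\<lambda>la. tensor_crystal (B_crystal n l s la) (Bdot_crystal n l s (conj_part la))))"
    unfolding crystals_isomorphic_def by (rule exI) (rule F_crystal_iso)
qed (unfold Fset_def Fdot_def, rule correspondence)

end
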